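(* Suppose $T$ is a tree with exactly two vertices of degree at least $3$. If $F$ is a graph with $X_F=X_T$, where $X_G$ denotes the chromatic symmetric function of a graph $G$, then $F\cong T$.
   Context: Graphs may possibly have loops or multiple edges. A proper coloring of a graph $G$ is a function $\kappa:V(G)\to\mathbb{Z}^+$ (positive integers) such that $\kappa(v)\ne\kappa(w)$ whenever $vw\in E(G)$. The chromatic symmetric function of $G$ is $$X_G=X_G(x_1,x_2,\dots)=\sum_{\kappa}\prod_{v\in V(G)}x_{\kappa(v)}$$ in commuting variables $x_1,x_2,\dots$, where the sum is over all proper colorings $\kappa$ of $G$. The symbol $\cong$ denotes graph isomorphism.
   Formalization: The graph F is additionally assumed to have no multiple edges (loops remain allowed), because doubling an edge of T leaves the chromatic symmetric function unchanged but gives a graph not isomorphic to T. *)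

theory Defs
  imports "HOL-Library.Multiset" "HOL-Library.FuncSet" "HOL-Library.Uprod"
begin

text \<open>
  Undirected graphs, possibly with loops (edges \<^term>\<open>Upair v v\<close>) and multiple edges
  (elements of multiplicity greater than one in the multiset of edges).
\<close>

datatype 'v multigraph = Multigraph (vertices: "'v set") (edges: "'v uprod multiset")

definition wf_multigraph :: "'v multigraph \<Rightarrow> bool" where
  "wf_multigraph G \<longleftrightarrow>
     finite (vertices G) \<and> (\<forall>e. e \<in># edges G \<longrightarrow> set_uprod e \<subseteq> vertices G)"

definition no_multiple_edges :: "'v multigraph \<Rightarrow> bool" where
  "no_multiple_edges G \<longleftrightarrow> (\<forall>e. count (edges G) e \<le> 1)"

text \<open>A loop contributes 2 to the degree of its vertex.\<close>

definition vertex_degree :: "'v multigraph \<Rightarrow> 'v \<Rightarrow> nat" where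
  "vertex_degree G v =
     size {#e \<in># edges G. v \<in> set_uprod e#} + size {#e \<in># edges G. e = Upair v v#}"

definition connected_multigraph :: "'v multigraph \<Rightarrow> bool" where
  "connected_multigraph G \<longleftrightarrow> vertices G \<noteq> {} \<and>
     (\<forall>u \<in> vertices G. \<forall>v \<in> vertices G. (u, v) \<in> {(a, b). Upair a b \<in># edges G}\<^sup>*)"

text \<open>
  A cycle visits distinct vertices \<open>v\<^sub>1, \<dots>, v\<^sub>k\<close> (\<open>k \<ge> 1\<close>) and uses the edges
  \<open>v\<^sub>1v\<^sub>2, \<dots>, v\<^sub>kv\<^sub>1\<close>, each at most as often as it occurs in the graph. In particular loops
  are cycles of length 1, and a cycle of length 2 needs two parallel edges.
\<close>

definition is_cycle :: "'v multigraph \<Rightarrow> 'v list \<Rightarrow> bool" where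
  "is_cycle G vs \<longleftrightarrow> vs \<noteq> [] \<and> distinct vs \<and> mset (map2 Upair vs (rotate1 vs)) \<subseteq># edges G"

definition is_tree :: "'v multigraph \<Rightarrow> bool" where
  "is_tree G \<longleftrightarrow> wf_multigraph G \<and> connected_multigraph G \<and> (\<nexists>vs. is_cycle G vs)"

definition isomorphic :: "'v multigraph \<Rightarrow> 'w multigraph \<Rightarrow> bool" (infix "\<cong>\<^sub>G" 50) where
  "G \<cong>\<^sub>G H \<longleftrightarrow> (\<exists>f. bij_betw f (vertices G) (vertices H) \<and>
                  image_mset (map_uprod f) (edges G) = edges H)"

definition proper_colorings :: "'v multigraph \<Rightarrow> ('v \<Rightarrow> nat) set" where
  "proper_colorings G = {\<kappa> \<in> vertices G \<rightarrow>\<^sub>E {1..}. \<forall>v w. Upair v w \<in># edges G \<longrightarrow> \<kappa> v \<noteq> \<kappa> w}"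

text \<open>
  A monomial in \<open>x\<^sub>1, x\<^sub>2, \<dots>\<close> is the multiset of the indices of its variables, and a formal power
  series is the function assigning to each monomial its coefficient.
\<close>

type_synonym monomial = "nat multiset"
type_synonym power_series = "monomial \<Rightarrow> int"

text \<open>The monomial \<open>\<Prod>v. x\<^bsub>\<kappa>(v)\<^esub>\<close>, with \<open>v\<close> ranging over the vertices.\<close>

definition coloring_monomial :: "'v multigraph \<Rightarrow> ('v \<Rightarrow> nat) \<Rightarrow> monomial" where
  "coloring_monomial G \<kappa> = {#\<kappa> v. v \<in># mset_set (vertices G)#}"

text \<open>
  The formal sum of the monomials of all proper colorings: the coefficient of \<open>m\<close> counts the
  proper colorings whose monomial is \<open>m\<close>, finitely many for a finite graph.
\<close>

definition chromatic_symmetric_function :: "'v multigraph \<Rightarrow> power_series" where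
  "chromatic_symmetric_function G =
     (\<lambda>m. int (card {\<kappa> \<in> proper_colorings G. coloring_monomial G \<kappa> = m}))"

lemma finite_proper_colorings_with_monomial:
  assumes "wf_multigraph G"
  shows "finite {\<kappa> \<in> proper_colorings G. coloring_monomial G \<kappa> = m}"
proof (rule finite_subset)
  have fin: "finite (vertices G)"
    using assms by (simp add: wf_multigraph_def)
  then show "{\<kappa> \<in> proper_colorings G. coloring_monomial G \<kappa> = m} \<subseteq> vertices G \<rightarrow>\<^sub>E set_mset m"
    by (auto simp: proper_colorings_def coloring_monomial_def PiE_iff extensional_def)
  show "finite (vertices G \<rightarrow>\<^sub>E set_mset m)"
    using fin by (simp add: finite_PiE)
qed

text \<open>
  The chromatic symmetric function does not see the multiplicities of edges, so it can
  determine a graph up to isomorphism only among graphs without multiple edges.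
\<close>

lemma chromatic_symmetric_function_cong:
  assumes "vertices G = vertices H" and "set_mset (edges G) = set_mset (edges H)"
  shows "chromatic_symmetric_function G = chromatic_symmetric_function H"
  using assms
  by (simp add: chromatic_symmetric_function_def proper_colorings_def coloring_monomial_def)

end

theory Submission
  imports Defs "HOL-Computational_Algebra.Polynomial" Complex_Main
begin

text \<open>
  Write \<open>e(Z)\<close> for the number of edges inside a vertex set \<open>Z\<close>. In a tree, the proper colourings
  that use \<open>q + s\<close> colours, the last \<open>s\<close> of them exactly on \<open>Z\<close>, number
  \<open>(q-1)^e(V-Z) q^(|V-Z|-e(V-Z)) (s-1)^e(Z) s^(|Z|-e(Z))\<close>. Hence the chromatic symmetric function
  determines the joint distribution of \<open>(|Z|, e(Z), e(V-Z))\<close>. For connected \<open>Z\<close>, that is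
  \<open>e(Z) = |Z| - 1\<close>, this gives the joint distribution of the size of \<open>Z\<close> and the number of edges
  leaving it. Single vertices give the degree sequence, so \<open>F\<close> also has two hubs.

  The connected sets with the most outgoing edges contain both hubs and no leaf. Their generating
  function by size is \<open>z^(d+1)\<close> times the product over all legs of \<open>1 + z + \<dots> + z^(l-1)\<close>, which gives the
  distance \<open>d\<close> of the hubs and the multiset of all leg lengths \<open>l\<close>. The connected sets containing both
  hubs or neither do not depend on how the legs are distributed. Mark each outgoing edge by
  \<open>2(1-z)\<close>: the sets containing exactly one hub then yield \<open>2z(1 - z^d)(A + B)\<close>, where \<open>A\<close> and \<open>B\<close> are the
  products of \<open>2 - z^l\<close> over the legs at either hub. As \<open>A B\<close> is known too, the pair \<open>{A, B}\<close> is
  determined.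
\<close>

section \<open>Rooted trees\<close>

text \<open>A tree is handled through a parent map with a height that drops by one at each step
  towards the root. Every edge then belongs to exactly one nonroot vertex, so edge counts become
  vertex counts; a set containing the root is connected iff it is closed under parents, and the
  edges leaving it lead to children outside. Only sets through the root are enumerated in this way:
  those through the other hub alone are reached by reversing the central path.

  The distribution counts connected sets without telling which hub a set contains, so only A + B is
  visible and never A itself. The weight 2(1-z) is chosen for what it does to a leg: a weight c(1-z)
  makes a leg of length n contribute c - (c-1)z^n. With c = 1 the legs disappear, with c = 0 only
  their total length is left, but 2 - z^n has the real root 2^(1/n), at which no factor 2 - z^k with
  0 < k < n vanishes. Hence a product of such factors determines the multiset of its
  exponents.\<close>

definition rooted :: "'a set \<Rightarrow> 'a uprod set \<Rightarrow> 'a \<Rightarrow> ('a \<Rightarrow> 'a) \<Rightarrow> ('a \<Rightarrow> nat) \<Rightarrow> bool" where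
  "rooted V E r par ht \<longleftrightarrow> finite V \<and> r \<in> V \<and> ht r = 0 \<and>
     (\<forall>x \<in> V - {r}. par x \<in> V \<and> ht x = Suc (ht (par x))) \<and>
     E = (\<lambda>x. Upair x (par x)) ` (V - {r})"

lemma rootedD:
  assumes "rooted V E r par ht"
  shows "finite V" "r \<in> V" "ht r = 0"
    "\<And>x. x \<in> V \<Longrightarrow> x \<noteq> r \<Longrightarrow> par x \<in> V"
    "\<And>x. x \<in> V \<Longrightarrow> x \<noteq> r \<Longrightarrow> ht x = Suc (ht (par x))"
    "E = (\<lambda>x. Upair x (par x)) ` (V - {r})"
  using assms by (auto simp: rooted_def)

text \<open>If two different vertices gave the same edge, each would be the parent of the other, and
  each height would exceed the other by one.\<close>

lemma rooted_inj:
  assumes "rooted V E r par ht"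
  shows "inj_on (\<lambda>x. Upair x (par x)) (V - {r})"
proof (rule inj_onI)
  fix x y assume xy: "x \<in> V - {r}" "y \<in> V - {r}" and eq: "Upair x (par x) = Upair y (par y)"
  have "ht x = Suc (ht (par x))" "ht y = Suc (ht (par y))"
    using rootedD(5)[OF assms] xy by auto
  with eq show "x = y" by auto
qed

lemma rooted_card_edges:
  assumes "rooted V E r par ht"
  shows "card E = card V - 1"
  using rooted_inj[OF assms] rootedD[OF assms] by (simp add: card_image)

lemma rooted_edge_subset:
  assumes "rooted V E r par ht" "e \<in> E"
  shows "set_uprod e \<subseteq> V"
  using rootedD[OF assms(1)] assms(2) by auto

lemma rooted_finite_edges: "rooted V E r par ht \<Longrightarrow> finite E"
  by (simp add: rooted_def)

text \<open>A breadth-first tree: \<open>ht\<close> is the distance from \<open>r\<close>, and the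
  last step of a shortest walk supplies a parent one level lower.\<close>

lemma exists_spanning_tree:
  fixes E :: "'a uprod set"
  assumes "finite V" "r \<in> V" and sub: "\<And>e. e \<in> E \<Longrightarrow> set_uprod e \<subseteq> V"
    and conn: "\<And>x. x \<in> V \<Longrightarrow> (r, x) \<in> {(a, b). Upair a b \<in> E}\<^sup>*"
  obtains S par ht where "rooted V S r par ht" "S \<subseteq> E"
proof -
  define R where "R = {(a, b). Upair a b \<in> E}"
  define ht where "ht x = (LEAST n. (r, x) \<in> R ^^ n)" for x
  define par where "par x = (SOME y. (y, x) \<in> R \<and> ht x = Suc (ht y))" for x
  have "ht r = 0" unfolding ht_def by (rule Least_equality) auto
  have ht: "(r, x) \<in> R ^^ ht x" if "x \<in> V" for x
    using conn[OF that] unfolding ht_def R_def[symmetric] by (metis LeastI rtrancl_imp_relpow)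
  have ht_le: "ht x \<le> n" if "(r, x) \<in> R ^^ n" for x n
    using that unfolding ht_def by (rule Least_le)
  have *: "(par x, x) \<in> R \<and> ht x = Suc (ht (par x))" if x: "x \<in> V" "x \<noteq> r" for x
  proof -
    obtain k where k: "ht x = Suc k" using ht[OF x(1)] x(2) by (cases "ht x") auto
    then obtain y where y: "(r, y) \<in> R ^^ k" "(y, x) \<in> R" using ht[OF x(1)] by auto
    have "y \<in> V" using sub y(2) by (force simp: R_def)
    have "(r, x) \<in> R ^^ Suc (ht y)" using ht[OF \<open>y \<in> V\<close>] y(2) by auto
    then have "ht y = k" using ht_le[OF y(1)] ht_le[of x "Suc (ht y)"] k by simp
    then show ?thesis unfolding par_def using someI[of "\<lambda>y. (y, x) \<in> R \<and> ht x = Suc (ht y)" y] k y(2) by simp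
  qed
  then have **: "Upair x (par x) \<in> E" if "x \<in> V" "x \<noteq> r" for x
    using that by (auto simp: R_def Upair_inject insert_commute) (metis Upair_inject)
  show ?thesis
  proof (rule that)
    show "rooted V ((\<lambda>x. Upair x (par x)) ` (V - {r})) r par ht"
      unfolding rooted_def using assms(1,2) \<open>ht r = 0\<close> * sub[OF **] by auto
    show "(\<lambda>x. Upair x (par x)) ` (V - {r}) \<subseteq> E" using ** by auto
  qed
qed

lemma rooted_connected:
  assumes "rooted V E r par ht" "x \<in> V" "y \<in> V"
  shows "(x, y) \<in> {(a, b). Upair a b \<in> E}\<^sup>*"
proof -
  define R where "R = {(a, b). Upair a b \<in> E}"
  have symR: "sym (R\<^sup>*)" by (rule sym_rtrancl) (auto simp: R_def sym_def Upair_inject, metis Upair_inject)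
  have up: "(x, r) \<in> R\<^sup>*" if "x \<in> V" for x
    using that
  proof (induction "ht x" arbitrary: x rule: less_induct)
    case less
    show ?case
    proof (cases "x = r")
      case False
      then have "par x \<in> V" "ht (par x) < ht x" "(x, par x) \<in> R"
        using rootedD[OF assms(1)] less.prems by (auto simp: R_def)
      then show ?thesis using less.hyps by (meson converse_rtrancl_into_rtrancl)
    qed simp
  qed
  show ?thesis using up[OF assms(2)] up[OF assms(3)] symR unfolding R_def[symmetric]
    by (meson rtrancl_trans symE)
qed

text \<open>A repeated vertex is removed by cutting off the detour back to it. Distinctness is what
  \<open>is_cycle\<close> asks of the vertices.\<close>

lemma rtrancl_distinct_path:
  assumes "(x, y) \<in> R\<^sup>*"
  shows "\<exists>p. p \<noteq> [] \<and> hd p = x \<and> last p = y \<and> distinct p \<and> successively (\<lambda>a b. (a, b) \<in> R) p"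
  using assms
proof (induction rule: converse_rtrancl_induct)
  case base
  show ?case by (rule exI[of _ "[y]"]) simp
next
  case (step x x')
  then obtain p where p: "p \<noteq> []" "hd p = x'" "last p = y" "distinct p" "successively (\<lambda>a b. (a, b) \<in> R) p"
    by blast
  show ?case
  proof (cases "x \<in> set p")
    case True
    then obtain as bs where "p = as @ x # bs" by (meson split_list)
    then show ?thesis using p by (intro exI[of _ "x # bs"]) (auto simp: successively_append_iff)
  next
    case False
    then show ?thesis using p step.hyps(1) by (intro exI[of _ "x # p"]) (auto simp: successively_Cons)
  qed
qed

text \<open>\<open>rotate1 (x # q)\<close> is \<open>q @ [x]\<close>, so with \<open>z = x\<close>
  this separates the edges of a cycle into those of a path and the closing edge.\<close>

lemma cycle_edges:
  "map2 Upair (x # q) (q @ [z]) = map2 Upair (x # q) q @ [Upair (last (x # q)) z]"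
  by (induction q arbitrary: x) auto

lemma path_edges_subset: "e \<in> set (map2 Upair (x # q) q) \<Longrightarrow> set_uprod e \<subseteq> set (x # q)"
proof (induction q arbitrary: x)
  case (Cons y q)
  then consider "e = Upair x y" | "e \<in> set (map2 Upair (y # q) q)" by auto
  then show ?case
  proof cases
    case 2
    then show ?thesis using Cons.IH[OF 2] by auto
  qed auto
qed simp

lemma path_edges_distinct: "distinct (x # q) \<Longrightarrow> distinct (map2 Upair (x # q) q)"
proof (induction q arbitrary: x)
  case (Cons y q)
  have "Upair x y \<notin> set (map2 Upair (y # q) q)"
  proof
    assume "Upair x y \<in> set (map2 Upair (y # q) q)"
    from path_edges_subset[OF this] show False using Cons.prems by auto
  qed
  moreover have "map2 Upair (x # y # q) (y # q) = Upair x y # map2 Upair (y # q) q" by simp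
  moreover have "distinct (map2 Upair (y # q) q)" using Cons by simp
  ultimately show ?case by (metis distinct.simps(2))
qed simp

lemma path_edges_in:
  "successively (\<lambda>a b. Upair a b \<in> E) (x # q) \<Longrightarrow> set (map2 Upair (x # q) q) \<subseteq> E"
  by (induction q arbitrary: x) auto

text \<open>An edge beyond a spanning tree closes a cycle with the tree path between its ends.
  Taking the surplus as a multiset difference treats loops and parallel copies like any other edge:
  the path then has one vertex or two.\<close>

lemma tree_rooted:
  assumes "is_tree T" "u \<in> vertices T"
  obtains par ht where "rooted (vertices T) (set_mset (edges T)) u par ht"
    "edges T = mset_set (set_mset (edges T))"
proof -
  have wf: "finite (vertices T)" "\<And>e. e \<in># edges T \<Longrightarrow> set_uprod e \<subseteq> vertices T"
    and acyc: "\<And>vs. \<not> is_cycle T vs"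
    using assms(1) by (auto simp: is_tree_def wf_multigraph_def)
  have "(u, x) \<in> {(a, b). Upair a b \<in># edges T}\<^sup>*" if "x \<in> vertices T" for x
    using assms that by (auto simp: is_tree_def connected_multigraph_def)
  then obtain S par ht where S: "rooted (vertices T) S u par ht" "S \<subseteq> set_mset (edges T)"
    using exists_spanning_tree[OF wf(1) assms(2) wf(2)] by blast
  have fin: "finite S" using rooted_finite_edges[OF S(1)] .
  have sub: "mset_set S \<subseteq># edges T"
    using fin S(2) by (auto simp: subseteq_mset_def count_mset_set' count_greater_eq_one_iff)
  have "edges T - mset_set S = {#}"
  proof (rule ccontr)
    assume "edges T - mset_set S \<noteq> {#}"
    then obtain e where e: "e \<in># edges T - mset_set S" by (meson multiset_nonemptyE)
    obtain x y where xy: "e = Upair y x" by (cases e) auto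
    have "e \<in># edges T" using e by (meson in_diffD)
    then have "x \<in> vertices T" "y \<in> vertices T" using wf(2) xy by force+
    from rtrancl_distinct_path[OF rooted_connected[OF S(1) this]] obtain p where p:
      "p \<noteq> []" "hd p = x" "last p = y" "distinct p" "successively (\<lambda>a b. Upair a b \<in> S) p" by auto
    obtain q where q: "p = x # q" using p by (cases p) auto
    have "mset (map2 Upair (x # q) q) = mset_set (set (map2 Upair (x # q) q))"
      using path_edges_distinct p(4) q by (metis mset_set_set)
    also have "\<dots> \<subseteq># mset_set S"
      using path_edges_in[of S x q] p(5) q fin by (metis finite_set msubset_mset_set_iff)
    \<comment> \<open>The path spends tree edges and \<open>e\<close> comes from the surplus, so the
      multiplicities suffice even if \<open>e\<close> is a copy of an edge of the path.\<close>
    finally have "mset (map2 Upair (x # q) q) + {#e#} \<subseteq># mset_set S + (edges T - mset_set S)"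
      using e by (intro subset_mset.add_mono) auto
    then have "is_cycle T p"
      unfolding is_cycle_def using p q cycle_edges[of x q x] xy sub by simp
    with acyc show False by blast
  qed
  then have eq: "edges T = mset_set S" using sub by (metis subset_mset.diff_add add.left_neutral)
  then have "set_mset (edges T) = S" using fin by simp
  then show ?thesis using that S(1) eq by metis
qed

section \<open>Colourings of trees\<close>

definition edges_in :: "'a uprod set \<Rightarrow> 'a set \<Rightarrow> nat" where
  "edges_in E W = card {e \<in> E. set_uprod e \<subseteq> W}"

definition restricted_colorings :: "'a set \<Rightarrow> 'a uprod set \<Rightarrow> ('a \<Rightarrow> nat set) \<Rightarrow> ('a \<Rightarrow> nat) set" where
  "restricted_colorings V E S = {\<kappa> \<in> PiE V S. \<forall>v w. Upair v w \<in> E \<longrightarrow> \<kappa> v \<noteq> \<kappa> w}"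

lemma rooted_edges_in:
  assumes "rooted V E r par ht" "W \<subseteq> V"
  shows "edges_in E W = card {x \<in> W. x \<noteq> r \<and> par x \<in> W}"
proof -
  have "{e \<in> E. set_uprod e \<subseteq> W} = (\<lambda>x. Upair x (par x)) ` {x \<in> W. x \<noteq> r \<and> par x \<in> W}"
    using assms rootedD(6)[OF assms(1)] by auto
  moreover have "inj_on (\<lambda>x. Upair x (par x)) {x \<in> W. x \<noteq> r \<and> par x \<in> W}"
    using assms(2) by (intro inj_on_subset[OF rooted_inj[OF assms(1)]]) auto
  ultimately show ?thesis by (simp add: edges_in_def card_image)
qed

lemma rooted_proper_iff:
  assumes "rooted V E r par ht"
  shows "(\<forall>v w. Upair v w \<in> E \<longrightarrow> \<kappa> v \<noteq> \<kappa> w) \<longleftrightarrow> (\<forall>x \<in> V - {r}. \<kappa> x \<noteq> \<kappa> (par x))"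
proof -
  have E: "E = (\<lambda>x. Upair x (par x)) ` (V - {r})" using rootedD(6)[OF assms] .
  show ?thesis
  proof (intro iffI ballI allI impI)
    fix x assume "\<forall>v w. Upair v w \<in> E \<longrightarrow> \<kappa> v \<noteq> \<kappa> w" "x \<in> V - {r}"
    then show "\<kappa> x \<noteq> \<kappa> (par x)" using E by auto
  next
    fix v w assume *: "\<forall>x\<in>V - {r}. \<kappa> x \<noteq> \<kappa> (par x)" "Upair v w \<in> E"
    then obtain x where "x \<in> V - {r}" "Upair v w = Upair x (par x)" using E by blast
    then show "\<kappa> v \<noteq> \<kappa> w" using * by (metis Upair_inject)
  qed
qed

text \<open>Colours are handed out from the root upwards: the parent of \<open>x\<close> forbids one colour of
  \<open>S x\<close> if it has the same palette, and none if its palette is disjoint.\<close>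

lemma card_restricted_colorings_aux:
  fixes S :: "'a \<Rightarrow> nat set"
  assumes rt: "rooted V E r par ht"
    and S: "\<And>x. finite (S x)" "\<And>x y. S x = S y \<or> S x \<inter> S y = {}"
    and "W \<subseteq> V"
  shows "card {\<kappa> \<in> PiE W S. \<forall>x \<in> W. x \<noteq> r \<and> par x \<in> W \<longrightarrow> \<kappa> x \<noteq> \<kappa> (par x)} =
    (\<Prod>x\<in>W. card (S x) - (if x \<noteq> r \<and> par x \<in> W \<and> S (par x) = S x then 1 else 0))"
  using \<open>W \<subseteq> V\<close>
proof (induction "card W" arbitrary: W)
  case 0
  then have "W = {}" using rootedD(1)[OF rt] by (metis card_0_eq finite_subset)
  then show ?case by (simp add: PiE_empty_domain)
next
  case (Suc n W)
  define good where "good W = {\<kappa> \<in> PiE W S. \<forall>x \<in> W. x \<noteq> r \<and> par x \<in> W \<longrightarrow> \<kappa> x \<noteq> \<kappa> (par x)}" for W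
  have fin: "finite W" using Suc.prems rootedD(1)[OF rt] by (meson finite_subset)
  have "W \<noteq> {}" using Suc.hyps(2) by auto
  \<comment> \<open>A vertex of largest height in \<open>W\<close> is the parent of no vertex of
    \<open>W\<close>, so it may be coloured last.\<close>
  then have "Max (ht ` W) \<in> ht ` W" using fin by simp
  then obtain x where "x \<in> W" "ht x = Max (ht ` W)" by auto
  then have x: "x \<in> W" "\<And>y. y \<in> W \<Longrightarrow> ht y \<le> ht x" using fin by auto
  define W' where "W' = W - {x}"
  have W: "W = insert x W'" "x \<notin> W'" "finite W'" "W' \<subseteq> V" "n = card W'"
    using x(1) fin Suc unfolding W'_def by auto
  have par_ne: "par y \<noteq> x" if "y \<in> W" "y \<noteq> r" for y
    using rootedD(5)[OF rt, of y] x(2)[OF that(1)] that Suc.prems by auto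
  define allowed where
    "allowed \<kappa> = (if x \<noteq> r \<and> par x \<in> W' then S x - {\<kappa> (par x)} else S x)" for \<kappa> :: "'a \<Rightarrow> nat"
  define m where "m = card (S x) - (if x \<noteq> r \<and> par x \<in> W' \<and> S (par x) = S x then 1 else 0)"
  have par_W': "par y \<in> W \<longleftrightarrow> par y \<in> W'" if "y \<in> W" "y \<noteq> r" for y
    using par_ne[OF that] W(1) by auto
  have "bij_betw (\<lambda>(\<kappa>, c). \<kappa>(x := c)) (SIGMA \<kappa>:good W'. allowed \<kappa>) (good W)"
  proof (rule bij_betw_byWitness[where f' = "\<lambda>\<kappa>. (restrict \<kappa> W', \<kappa> x)"])
    show "\<forall>a\<in>Sigma (good W') allowed. (\<lambda>\<kappa>. (restrict \<kappa> W', \<kappa> x)) ((\<lambda>(\<kappa>, c). \<kappa>(x := c)) a) = a"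
      using W(2) by (force simp: good_def PiE_def extensional_def restrict_def fun_eq_iff)
    show "\<forall>\<kappa>\<in>good W. (\<lambda>(\<kappa>, c). \<kappa>(x := c)) (restrict \<kappa> W', \<kappa> x) = \<kappa>"
      by (auto simp: good_def W(1) PiE_def extensional_def restrict_def fun_eq_iff)
    show "(\<lambda>(\<kappa>, c). \<kappa>(x := c)) ` Sigma (good W') allowed \<subseteq> good W"
    proof clarify
      fix \<kappa> c assume \<kappa>: "\<kappa> \<in> good W'" and c: "c \<in> allowed \<kappa>"
      have "(\<kappa>(x := c)) y \<noteq> (\<kappa>(x := c)) (par y)" if y: "y \<in> W" "y \<noteq> r" "par y \<in> W" for y
      proof (cases "y = x")
        case True
        then show ?thesis using c y par_ne[OF y(1,2)] par_W'[OF y(1,2)] by (auto simp: allowed_def)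
      next
        case False
        then show ?thesis using \<kappa> y par_ne[OF y(1,2)] par_W'[OF y(1,2)] W(1) by (auto simp: good_def)
      qed
      moreover have "\<kappa>(x := c) \<in> PiE W S"
        using \<kappa> c W(1) by (auto simp: good_def allowed_def PiE_def extensional_def split: if_splits)
      ultimately show "\<kappa>(x := c) \<in> good W" by (simp add: good_def)
    qed
    show "(\<lambda>\<kappa>. (restrict \<kappa> W', \<kappa> x)) ` good W \<subseteq> Sigma (good W') allowed"
    proof clarify
      fix \<kappa> assume \<kappa>: "\<kappa> \<in> good W"
      then show "restrict \<kappa> W' \<in> good W' \<and> \<kappa> x \<in> allowed (restrict \<kappa> W')"
        using x(1) par_W'[OF x(1)] by (auto simp: good_def allowed_def W(1) PiE_iff)
    qed
  qed
  then have "card (good W) = card (SIGMA \<kappa>:good W'. allowed \<kappa>)" by (metis bij_betw_same_card)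
  also have "\<dots> = (\<Sum>\<kappa>\<in>good W'. card (allowed \<kappa>))"
  proof (rule card_SigmaI)
    show "finite (good W')"
      using finite_PiE[OF W(3) S(1)] unfolding good_def by (rule finite_subset[rotated]) auto
    show "\<forall>\<kappa>\<in>good W'. finite (allowed \<kappa>)" using S(1) by (simp add: allowed_def)
  qed
  also have "\<dots> = (\<Sum>\<kappa>\<in>good W'. m)"
  proof (rule sum.cong[OF refl])
    fix \<kappa> assume \<kappa>: "\<kappa> \<in> good W'"
    show "card (allowed \<kappa>) = m"
    proof (cases "x \<noteq> r \<and> par x \<in> W'")
      case True
      then have "\<kappa> (par x) \<in> S (par x)" using \<kappa> by (auto simp: good_def)
      \<comment> \<open>Different palettes are disjoint, so the colour of the parent takes nothing
        away from \<open>S x\<close>.\<close>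
      moreover have "S x - {\<kappa> (par x)} = S x" if "S (par x) \<noteq> S x"
        using calculation S(2)[of "par x" x] that by auto
      ultimately show ?thesis using True by (auto simp: allowed_def m_def)
    qed (auto simp: allowed_def m_def)
  qed
  also have "\<dots> = m * card (good W')" by simp
  also have "card (good W') =
    (\<Prod>y\<in>W'. card (S y) - (if y \<noteq> r \<and> par y \<in> W' \<and> S (par y) = S y then 1 else 0))"
    unfolding good_def using Suc.hyps(1)[OF W(5) W(4)] .
  also have "\<dots> = (\<Prod>y\<in>W'. card (S y) - (if y \<noteq> r \<and> par y \<in> W \<and> S (par y) = S y then 1 else 0))"
    using par_W' W(1) by (intro prod.cong refl) auto
  also have "m = card (S x) - (if x \<noteq> r \<and> par x \<in> W \<and> S (par x) = S x then 1 else 0)"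
    using par_W'[OF x(1)] by (auto simp: m_def)
  finally show ?case using W(1-3) by (simp add: good_def)
qed

lemma card_restricted_colorings:
  fixes S :: "'a \<Rightarrow> nat set"
  assumes rt: "rooted V E r par ht"
    and "\<And>x. finite (S x)" "\<And>x y. S x = S y \<or> S x \<inter> S y = {}"
  shows "card (restricted_colorings V E S) =
    (\<Prod>x\<in>V. card (S x) - (if x \<noteq> r \<and> S (par x) = S x then 1 else 0))"
proof -
  have "restricted_colorings V E S = {\<kappa> \<in> PiE V S. \<forall>x \<in> V. x \<noteq> r \<and> par x \<in> V \<longrightarrow> \<kappa> x \<noteq> \<kappa> (par x)}"
    unfolding restricted_colorings_def rooted_proper_iff[OF rt] using rootedD(4)[OF rt] by blast
  then have "card (restricted_colorings V E S) =
    (\<Prod>x\<in>V. card (S x) - (if x \<noteq> r \<and> par x \<in> V \<and> S (par x) = S x then 1 else 0))"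
    using card_restricted_colorings_aux[OF assms, of V] by simp
  also have "\<dots> = (\<Prod>x\<in>V. card (S x) - (if x \<noteq> r \<and> S (par x) = S x then 1 else 0))"
    using rootedD(4)[OF rt] by (intro prod.cong refl) auto
  finally show ?thesis .
qed

lemma prod_two_valued:
  fixes a b :: "'b :: comm_semiring_1"
  assumes "finite A"
  shows "(\<Prod>x\<in>A. if P x then a else b) = a ^ card {x \<in> A. P x} * b ^ (card A - card {x \<in> A. P x})"
proof -
  have "(\<Prod>x\<in>A. if P x then a else b) = (\<Prod>x\<in>{x \<in> A. P x}. a) * (\<Prod>x\<in>{x \<in> A. \<not> P x}. b)"
    using assms by (subst prod.If_cases) (auto simp: Int_def Compl_eq intro!: arg_cong2[where f="(*)"] prod.cong)
  moreover have "card {x \<in> A. \<not> P x} = card A - card {x \<in> A. P x}"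
  proof -
    have "{x \<in> A. \<not> P x} = A - {x \<in> A. P x}" by auto
    then show ?thesis using assms by (simp add: card_Diff_subset)
  qed
  ultimately show ?thesis by simp
qed

lemma card_uniform_colorings:
  assumes rt: "rooted V E r par ht"
  shows "card (restricted_colorings V E (\<lambda>_. {1..q})) = q * (q - 1) ^ (card V - 1)"
proof -
  have "card (restricted_colorings V E (\<lambda>_. {1..q})) = (\<Prod>x\<in>V. if x = r then q else q - 1)"
    using card_restricted_colorings[OF rt, of "\<lambda>_. {1..q}"] by (auto intro: prod.cong)
  also have "\<dots> = q ^ card {x \<in> V. x = r} * (q - 1) ^ (card V - card {x \<in> V. x = r})"
    using rootedD(1)[OF rt] by (rule prod_two_valued)
  also have "{x \<in> V. x = r} = {r}" using rootedD(2)[OF rt] by auto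
  finally show ?thesis by simp
qed

lemma card_two_palette_colorings:
  assumes rt: "rooted V E r par ht" and "q \<ge> 1" "s \<ge> 1" "Z \<subseteq> V"
  shows "card (restricted_colorings V E (\<lambda>x. if x \<in> Z then {q + 1..q + s} else {1..q})) =
    (q - 1) ^ edges_in E (V - Z) * q ^ (card (V - Z) - edges_in E (V - Z)) *
    ((s - 1) ^ edges_in E Z * s ^ (card Z - edges_in E Z))"
proof -
  let ?S = "\<lambda>x. if x \<in> Z then {q + 1..q + s} else {1..q}"
  \<comment> \<open>Since \<open>s \<ge> 1\<close> the two palettes differ, so \<open>x\<close> and
    \<open>par x\<close> have the same palette exactly when both lie in \<open>Z\<close> or both lie
    outside.\<close>
  have ne: "{q + 1..q + s} \<noteq> {1..q}"
  proof
    assume "{q + 1..q + s} = {1..q}"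
    then have "q + 1 \<in> {1..q}" using assms(3) by (metis atLeastAtMost_iff add_left_mono order_refl)
    then show False by simp
  qed
  have fin: "finite V" "finite Z" using rootedD(1)[OF rt] assms(4) finite_subset by auto
  have "card (restricted_colorings V E ?S) = (\<Prod>x\<in>V. card (?S x) - (if x \<noteq> r \<and> ?S (par x) = ?S x then 1 else 0))"
    by (rule card_restricted_colorings[OF rt]) auto
  also have "\<dots> = (\<Prod>x\<in>V - Z. card (?S x) - (if x \<noteq> r \<and> ?S (par x) = ?S x then 1 else 0)) *
      (\<Prod>x\<in>Z. card (?S x) - (if x \<noteq> r \<and> ?S (par x) = ?S x then 1 else 0))"
    using fin(1) assms(4) by (simp add: prod.subset_diff)
  also have "(\<Prod>x\<in>V - Z. card (?S x) - (if x \<noteq> r \<and> ?S (par x) = ?S x then 1 else 0)) =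
     (\<Prod>x\<in>V - Z. if x \<noteq> r \<and> par x \<in> V - Z then q - 1 else q)"
    using ne rootedD(4)[OF rt] by (intro prod.cong refl) auto
  also have "\<dots> = (q - 1) ^ edges_in E (V - Z) * q ^ (card (V - Z) - edges_in E (V - Z))"
    using fin by (subst prod_two_valued) (auto simp: rooted_edges_in[OF rt])
  also have "(\<Prod>x\<in>Z. card (?S x) - (if x \<noteq> r \<and> ?S (par x) = ?S x then 1 else 0)) =
     (\<Prod>x\<in>Z. if x \<noteq> r \<and> par x \<in> Z then s - 1 else s)"
    using ne by (intro prod.cong refl) auto
  also have "\<dots> = (s - 1) ^ edges_in E Z * s ^ (card Z - edges_in E Z)"
    using fin assms(4) by (subst prod_two_valued) (auto simp: rooted_edges_in[OF rt])
  finally show ?thesis .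
qed

section \<open>What the chromatic symmetric function says about vertex sets\<close>

definition stat :: "'a set \<Rightarrow> 'a uprod set \<Rightarrow> 'a set \<Rightarrow> nat \<times> nat \<times> nat" where
  "stat V E Z = (card Z, edges_in E Z, edges_in E (V - Z))"

definition stat_mset :: "'a set \<Rightarrow> 'a uprod set \<Rightarrow> (nat \<times> nat \<times> nat) multiset" where
  "stat_mset V E = image_mset (stat V E) (mset_set (Pow V))"

text \<open>The condition \<open>Q\<close> sees only the monomial, and the bound \<open>N\<close>
  leaves finitely many colourings. Their number is therefore a finite sum of coefficients of the
  chromatic symmetric function.\<close>

definition bounded_colorings :: "'v multigraph \<Rightarrow> nat \<Rightarrow> (nat multiset \<Rightarrow> bool) \<Rightarrow> ('v \<Rightarrow> nat) set" where
  "bounded_colorings G N Q = {\<kappa> \<in> proper_colorings G.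
     set_mset (coloring_monomial G \<kappa>) \<subseteq> {1..N} \<and> Q (coloring_monomial G \<kappa>)}"

lemma set_coloring_monomial:
  "finite (vertices G) \<Longrightarrow> set_mset (coloring_monomial G \<kappa>) = \<kappa> ` vertices G"
  by (simp add: coloring_monomial_def)

lemma finite_bounded_colorings:
  assumes "wf_multigraph G"
  shows "finite (bounded_colorings G N Q)"
proof (rule finite_subset)
  have fin: "finite (vertices G)" using assms by (simp add: wf_multigraph_def)
  then show "bounded_colorings G N Q \<subseteq> vertices G \<rightarrow>\<^sub>E {1..N}"
    by (auto simp: bounded_colorings_def set_coloring_monomial proper_colorings_def PiE_def)
  show "finite (vertices G \<rightarrow>\<^sub>E {1..N})" using fin by (simp add: finite_PiE)
qed

text \<open>\<open>M\<close> may contain monomials that no colouring of \<open>G\<close> has, so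
  that one index set can serve two graphs at once.\<close>

lemma card_bounded_colorings_eq_sum:
  assumes "wf_multigraph G" "finite M"
    and "\<And>\<kappa>. \<kappa> \<in> bounded_colorings G N Q \<Longrightarrow> coloring_monomial G \<kappa> \<in> M"
    and M: "\<And>m. m \<in> M \<Longrightarrow> set_mset m \<subseteq> {1..N} \<and> Q m"
  shows "int (card (bounded_colorings G N Q)) = (\<Sum>m\<in>M. chromatic_symmetric_function G m)"
proof -
  have "bounded_colorings G N Q = (\<Union>m\<in>M. {\<kappa> \<in> proper_colorings G. coloring_monomial G \<kappa> = m})"
  proof (intro equalityI subsetI)
    fix \<kappa> assume "\<kappa> \<in> bounded_colorings G N Q"
    with assms(3)[OF this] show "\<kappa> \<in> (\<Union>m\<in>M. {\<kappa> \<in> proper_colorings G. coloring_monomial G \<kappa> = m})"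
      unfolding bounded_colorings_def by blast
  next
    fix \<kappa> assume "\<kappa> \<in> (\<Union>m\<in>M. {\<kappa> \<in> proper_colorings G. coloring_monomial G \<kappa> = m})"
    then have "\<kappa> \<in> proper_colorings G" "coloring_monomial G \<kappa> \<in> M" by auto
    with M[OF this(2)] show "\<kappa> \<in> bounded_colorings G N Q" unfolding bounded_colorings_def by blast
  qed
  moreover have "card (\<Union>m\<in>M. {\<kappa> \<in> proper_colorings G. coloring_monomial G \<kappa> = m}) =
    (\<Sum>m\<in>M. card {\<kappa> \<in> proper_colorings G. coloring_monomial G \<kappa> = m})"
    by (rule card_UN_disjoint[OF assms(2)])
      (use finite_proper_colorings_with_monomial[OF assms(1)] in blast)+
  ultimately have "card (bounded_colorings G N Q) =
    (\<Sum>m\<in>M. card {\<kappa> \<in> proper_colorings G. coloring_monomial G \<kappa> = m})" by simp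
  then show ?thesis by (simp add: chromatic_symmetric_function_def)
qed

lemma card_bounded_colorings_cong:
  assumes "wf_multigraph F" "wf_multigraph T"
    and "chromatic_symmetric_function F = chromatic_symmetric_function T"
  shows "card (bounded_colorings F N Q) = card (bounded_colorings T N Q)"
proof -
  let ?M = "coloring_monomial F ` bounded_colorings F N Q \<union> coloring_monomial T ` bounded_colorings T N Q"
  have fin: "finite ?M" using finite_bounded_colorings[OF assms(1)] finite_bounded_colorings[OF assms(2)] by simp
  have M: "set_mset m \<subseteq> {1..N} \<and> Q m" if "m \<in> ?M" for m
    using that by (auto simp: bounded_colorings_def)
  have "int (card (bounded_colorings F N Q)) = (\<Sum>m\<in>?M. chromatic_symmetric_function F m)"
    by (rule card_bounded_colorings_eq_sum[OF assms(1) fin _ M]) auto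
  moreover have "int (card (bounded_colorings T N Q)) = (\<Sum>m\<in>?M. chromatic_symmetric_function T m)"
    by (rule card_bounded_colorings_eq_sum[OF assms(2) fin _ M]) auto
  ultimately show ?thesis using assms(3) by simp
qed

lemma bounded_colorings_uniform:
  assumes "wf_multigraph G"
  shows "bounded_colorings G q (\<lambda>_. True) =
    restricted_colorings (vertices G) (set_mset (edges G)) (\<lambda>_. {1..q})"
proof -
  have fin: "finite (vertices G)" using assms by (simp add: wf_multigraph_def)
  show ?thesis
    unfolding bounded_colorings_def set_coloring_monomial[OF fin] proper_colorings_def
      restricted_colorings_def by (auto simp: PiE_def)
qed

lemma count_image_mset_set:
  "finite A \<Longrightarrow> count (image_mset f (mset_set A)) y = card {a \<in> A. f a = y}"
  by (simp add: count_image_mset vimage_def Int_def conj_commute)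

text \<open>The monomial shows how many vertices have a colour above \<open>q\<close>, but not which
  ones; the sum sorts the colourings by the set \<open>Z\<close> of these vertices.\<close>

lemma card_bounded_colorings_two_palettes:
  fixes G :: "'a multigraph"
  assumes "wf_multigraph G"
  defines "V \<equiv> vertices G" and "E \<equiv> set_mset (edges G)"
  shows "card (bounded_colorings G (q + s) (\<lambda>m. size (filter_mset (\<lambda>c. c > q) m) = k)) =
    (\<Sum>Z | Z \<subseteq> V \<and> card Z = k.
      card (restricted_colorings V E (\<lambda>x. if x \<in> Z then {q + 1..q + s} else {1..q})))"
proof -
  let ?R = "\<lambda>Z. restricted_colorings V E (\<lambda>x. if x \<in> Z then {q + 1..q + s} else {1..q})"
  have fin: "finite V" using assms(1) by (simp add: wf_multigraph_def V_def)
  have size: "size (filter_mset (\<lambda>c. c > q) (coloring_monomial G \<kappa>)) = card {v \<in> V. \<kappa> v > q}" for \<kappa>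
    using fin by (simp add: coloring_monomial_def filter_mset_image_mset V_def)
  have Z: "{v \<in> V. \<kappa> v > q} = Z" if "\<kappa> \<in> ?R Z" "Z \<subseteq> V" for \<kappa> Z
  proof -
    have "\<kappa> v \<in> (if v \<in> Z then {q + 1..q + s} else {1..q})" if "v \<in> V" for v
      using \<open>\<kappa> \<in> ?R Z\<close> that unfolding restricted_colorings_def by blast
    then have "\<kappa> v > q \<longleftrightarrow> v \<in> Z" if "v \<in> V" for v
      using that by (cases "v \<in> Z") force+
    then show ?thesis using \<open>Z \<subseteq> V\<close> by auto
  qed
  have B: "\<kappa> \<in> bounded_colorings G (q + s) Q \<longleftrightarrow> \<kappa> \<in> extensional V \<and> (\<forall>v \<in> V. \<kappa> v \<in> {1..q + s}) \<and>
      (\<forall>v w. Upair v w \<in> E \<longrightarrow> \<kappa> v \<noteq> \<kappa> w) \<and> Q (coloring_monomial G \<kappa>)" for \<kappa> Q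
    using fin by (auto simp: bounded_colorings_def set_coloring_monomial proper_colorings_def
        PiE_iff V_def E_def)
  have R: "\<kappa> \<in> ?R Z \<longleftrightarrow> \<kappa> \<in> extensional V \<and>
      (\<forall>v \<in> V. \<kappa> v \<in> (if v \<in> Z then {q + 1..q + s} else {1..q})) \<and>
      (\<forall>v w. Upair v w \<in> E \<longrightarrow> \<kappa> v \<noteq> \<kappa> w)" for \<kappa> Z
    unfolding restricted_colorings_def PiE_iff by blast
  have eq: "bounded_colorings G (q + s) (\<lambda>m. size (filter_mset (\<lambda>c. c > q) m) = k) =
    (\<Union>Z\<in>{Z. Z \<subseteq> V \<and> card Z = k}. ?R Z)" (is "?B = ?U")
  proof (intro equalityI subsetI)
    fix \<kappa> assume \<kappa>: "\<kappa> \<in> ?B"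
    then have "\<kappa> \<in> ?R {v \<in> V. \<kappa> v > q}" "card {v \<in> V. \<kappa> v > q} = k"
      unfolding B R size by auto
    then show "\<kappa> \<in> ?U" by (intro UN_I[of "{v \<in> V. \<kappa> v > q}"]) auto
  next
    fix \<kappa> assume "\<kappa> \<in> ?U"
    then obtain Z where Z': "Z \<subseteq> V" "card Z = k" "\<kappa> \<in> ?R Z" by blast
    have "\<kappa> x \<in> {1..q + s}" if "x \<in> V" for x
    proof -
      have "\<kappa> x \<in> (if x \<in> Z then {q + 1..q + s} else {1..q})" using Z'(3) that unfolding R by blast
      then show ?thesis by (cases "x \<in> Z") auto
    qed
    then show "\<kappa> \<in> ?B" using Z'(3) Z(1)[OF Z'(3,1)] Z'(2) unfolding B R size by simp
  qed
  show ?thesis unfolding eq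
  proof (rule card_UN_disjoint)
    show "finite {Z. Z \<subseteq> V \<and> card Z = k}" using fin by simp
    show "\<forall>Z\<in>{Z. Z \<subseteq> V \<and> card Z = k}. finite (?R Z)"
    proof
      fix Z
      have "finite (PiE V (\<lambda>x. if x \<in> Z then {q + 1..q + s} else {1..q}))" using fin by (intro finite_PiE) auto
      then show "finite (?R Z)" unfolding restricted_colorings_def by (rule finite_subset[rotated]) auto
    qed
    show "\<forall>i\<in>{Z. Z \<subseteq> V \<and> card Z = k}. \<forall>j\<in>{Z. Z \<subseteq> V \<and> card Z = k}. i \<noteq> j \<longrightarrow> ?R i \<inter> ?R j = {}"
      using Z by blast
  qed
qed

text \<open>The polynomials \<open>(q - 1)^i q^(N - i)\<close> are linearly independent: after
  division by \<open>q^N\<close> they are the powers of \<open>1 - 1/q\<close>, which takes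
  infinitely many values. The weights are arbitrary reals so that the lemma can be used twice, the
  second time on the weights left over from the first.\<close>

lemma power_basis_independent:
  fixes w :: "'a \<Rightarrow> real" and w' :: "'b \<Rightarrow> real"
  assumes fin: "finite P" "finite P'"
    and le: "\<And>Z. Z \<in> P \<Longrightarrow> i Z \<le> N" "\<And>Z. Z \<in> P' \<Longrightarrow> i' Z \<le> N"
    and eq: "\<And>q::nat. q \<ge> 1 \<Longrightarrow> (\<Sum>Z\<in>P. w Z * (real (q - 1) ^ i Z * real q ^ (N - i Z))) =
      (\<Sum>Z\<in>P'. w' Z * (real (q - 1) ^ i' Z * real q ^ (N - i' Z)))"
  shows "(\<Sum>Z | Z \<in> P \<and> i Z = j. w Z) = (\<Sum>Z | Z \<in> P' \<and> i' Z = j. w' Z)"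
proof -
  define p where "p = (\<Sum>Z\<in>P. monom (w Z) (i Z))"
  define p' where "p' = (\<Sum>Z\<in>P'. monom (w' Z) (i' Z))"
  have scale: "real (q - 1) ^ a * real q ^ (N - a) = real q ^ N * (real (q - 1) / real q) ^ a"
    if "q \<ge> 1" "a \<le> N" for q a
    using that by (simp add: power_divide power_diff)
  have root: "poly (p - p') (real (q - 1) / real q) = 0" if q: "q \<ge> 1" for q
  proof -
    have "(\<Sum>Z\<in>P. w Z * (real (q - 1) ^ i Z * real q ^ (N - i Z))) = real q ^ N * poly p (real (q - 1) / real q)"
      unfolding p_def poly_sum sum_distrib_left
      by (intro sum.cong refl) (simp only: scale[OF q le(1)] poly_monom mult.left_commute)
    moreover have "(\<Sum>Z\<in>P'. w' Z * (real (q - 1) ^ i' Z * real q ^ (N - i' Z))) =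
        real q ^ N * poly p' (real (q - 1) / real q)"
      unfolding p'_def poly_sum sum_distrib_left
      by (intro sum.cong refl) (simp only: scale[OF q le(2)] poly_monom mult.left_commute)
    ultimately show ?thesis using eq[OF q] q by simp
  qed
  have "inj_on (\<lambda>q::nat. real (q - 1) / real q) {1..}"
  proof (rule inj_onI)
    fix a b :: nat assume "a \<in> {1..}" "b \<in> {1..}" "real (a - 1) / real a = real (b - 1) / real b"
    then have "(real a - 1) * real b = (real b - 1) * real a"
      by (simp add: of_nat_diff frac_eq_eq)
    then show "a = b" by (simp add: algebra_simps)
  qed
  then have "infinite ((\<lambda>q::nat. real (q - 1) / real q) ` {1..})"
    using infinite_Ici finite_imageD by blast
  moreover have "(\<lambda>q::nat. real (q - 1) / real q) ` {1..} \<subseteq> {x. poly (p - p') x = 0}"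
    using root by auto
  ultimately have "p - p' = 0" using poly_roots_finite finite_subset by blast
  then have "coeff p j = coeff p' j" by simp
  then show ?thesis
    using fin by (simp add: p_def p'_def coeff_sum sum.inter_filter)
qed

text \<open>For each size \<open>k\<close>, the two-palette counts agree for all \<open>q\<close>
  and \<open>s\<close>. Comparing coefficients in \<open>s\<close>, with weights still depending on
  \<open>q\<close>, fixes \<open>edges_in E Z\<close>; comparing in \<open>q\<close>, with weights
  1, then fixes \<open>edges_in E (V - Z)\<close>.\<close>

lemma stat_mset_eq:
  fixes F :: "'a multigraph" and T :: "'b multigraph"
  assumes wf: "wf_multigraph F" "wf_multigraph T"
    and csf: "chromatic_symmetric_function F = chromatic_symmetric_function T"
    and card_eq: "card (vertices F) = card (vertices T)"
    and rF: "rooted (vertices F) (set_mset (edges F)) rF parF htF"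
    and rT: "rooted (vertices T) (set_mset (edges T)) rT parT htT"
  shows "stat_mset (vertices F) (set_mset (edges F)) = stat_mset (vertices T) (set_mset (edges T))"
proof (rule multiset_eqI)
  fix t :: "nat \<times> nat \<times> nat"
  obtain k i j where t: "t = (k, i, j)" by (cases t) auto
  let ?V = "vertices F" and ?V' = "vertices T"
  let ?E = "set_mset (edges F)" and ?E' = "set_mset (edges T)"
  define n where "n = card ?V"
  let ?P = "{Z. Z \<subseteq> ?V \<and> card Z = k}" and ?P' = "{Z. Z \<subseteq> ?V' \<and> card Z = k}"
  have fin: "finite ?V" "finite ?V'" using wf by (auto simp: wf_multigraph_def)
  have finP: "finite ?P" "finite ?P'" using fin by auto
  have le: "edges_in ?E Z \<le> card Z" if "Z \<subseteq> ?V" for Z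
    unfolding rooted_edges_in[OF rF that] by (rule card_mono[OF finite_subset[OF that fin(1)]]) auto
  have le': "edges_in ?E' Z \<le> card Z" if "Z \<subseteq> ?V'" for Z
    unfolding rooted_edges_in[OF rT that] by (rule card_mono[OF finite_subset[OF that fin(2)]]) auto
  have cd: "card (?V - Z) = n - k" if "Z \<in> ?P" for Z
    using that fin(1) card_Diff_subset[OF finite_subset[OF _ fin(1)], of Z] by (simp add: n_def)
  have cd': "card (?V' - Z) = n - k" if "Z \<in> ?P'" for Z
    using that fin(2) card_Diff_subset[OF finite_subset[OF _ fin(2)], of Z] by (simp add: n_def card_eq)
  have *: "(\<Sum>Z\<in>?P. real (q - 1) ^ edges_in ?E (?V - Z) * real q ^ (n - k - edges_in ?E (?V - Z)) *
        (real (s - 1) ^ edges_in ?E Z * real s ^ (k - edges_in ?E Z))) =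
      (\<Sum>Z\<in>?P'. real (q - 1) ^ edges_in ?E' (?V' - Z) * real q ^ (n - k - edges_in ?E' (?V' - Z)) *
        (real (s - 1) ^ edges_in ?E' Z * real s ^ (k - edges_in ?E' Z)))"
    if qs: "q \<ge> 1" "s \<ge> 1" for q s :: nat
  proof -
    have "(\<Sum>Z\<in>?P. card (restricted_colorings ?V ?E (\<lambda>x. if x \<in> Z then {q + 1..q + s} else {1..q}))) =
        (\<Sum>Z\<in>?P'. card (restricted_colorings ?V' ?E' (\<lambda>x. if x \<in> Z then {q + 1..q + s} else {1..q})))"
      unfolding card_bounded_colorings_two_palettes[OF wf(1), symmetric]
        card_bounded_colorings_two_palettes[OF wf(2), symmetric]
      by (rule card_bounded_colorings_cong[OF wf csf])
    also have "(\<Sum>Z\<in>?P. card (restricted_colorings ?V ?E (\<lambda>x. if x \<in> Z then {q + 1..q + s} else {1..q}))) =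
      (\<Sum>Z\<in>?P. (q - 1) ^ edges_in ?E (?V - Z) * q ^ (n - k - edges_in ?E (?V - Z)) *
        ((s - 1) ^ edges_in ?E Z * s ^ (k - edges_in ?E Z)))"
      by (rule sum.cong[OF refl], subst card_two_palette_colorings[OF rF qs]) (use cd in auto)
    also have "(\<Sum>Z\<in>?P'. card (restricted_colorings ?V' ?E' (\<lambda>x. if x \<in> Z then {q + 1..q + s} else {1..q}))) =
      (\<Sum>Z\<in>?P'. (q - 1) ^ edges_in ?E' (?V' - Z) * q ^ (n - k - edges_in ?E' (?V' - Z)) *
        ((s - 1) ^ edges_in ?E' Z * s ^ (k - edges_in ?E' Z)))"
      by (rule sum.cong[OF refl], subst card_two_palette_colorings[OF rT qs]) (use cd' in auto)
    finally have "real (\<Sum>Z\<in>?P. (q - 1) ^ edges_in ?E (?V - Z) * q ^ (n - k - edges_in ?E (?V - Z)) *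
        ((s - 1) ^ edges_in ?E Z * s ^ (k - edges_in ?E Z))) =
      real (\<Sum>Z\<in>?P'. (q - 1) ^ edges_in ?E' (?V' - Z) * q ^ (n - k - edges_in ?E' (?V' - Z)) *
        ((s - 1) ^ edges_in ?E' Z * s ^ (k - edges_in ?E' Z)))"
      by (rule arg_cong)
    then show ?thesis by (simp only: of_nat_sum of_nat_mult of_nat_power)
  qed
  have "(\<Sum>Z | Z \<in> ?P \<and> edges_in ?E Z = i. real (q - 1) ^ edges_in ?E (?V - Z) * real q ^ (n - k - edges_in ?E (?V - Z)))
     = (\<Sum>Z | Z \<in> ?P' \<and> edges_in ?E' Z = i. real (q - 1) ^ edges_in ?E' (?V' - Z) * real q ^ (n - k - edges_in ?E' (?V' - Z)))"
    if "q \<ge> 1" for q :: nat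
  proof (rule power_basis_independent[OF finP, where N = k])
    show "edges_in ?E Z \<le> k" if "Z \<in> ?P" for Z using le[of Z] that by simp
    show "edges_in ?E' Z \<le> k" if "Z \<in> ?P'" for Z using le'[of Z] that by simp
  qed (rule *[OF that])
  note ** = this
  have b: "edges_in ?E (?V - Z) \<le> n - k" if "Z \<in> ?P" for Z
    using le[of "?V - Z"] cd[OF that] by simp
  have b': "edges_in ?E' (?V' - Z) \<le> n - k" if "Z \<in> ?P'" for Z
    using le'[of "?V' - Z"] cd'[OF that] by simp
  have "(\<Sum>Z | Z \<in> {Z. Z \<in> ?P \<and> edges_in ?E Z = i} \<and> edges_in ?E (?V - Z) = j. 1::real)
     = (\<Sum>Z | Z \<in> {Z. Z \<in> ?P' \<and> edges_in ?E' Z = i} \<and> edges_in ?E' (?V' - Z) = j. 1)"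
  proof (rule power_basis_independent[where N = "n - k"])
    show "finite {Z \<in> ?P. edges_in ?E Z = i}" "finite {Z \<in> ?P'. edges_in ?E' Z = i}"
      by (rule finite_subset[OF _ finP(1)], blast) (rule finite_subset[OF _ finP(2)], blast)
    show "edges_in ?E (?V - Z) \<le> n - k" if "Z \<in> {Z \<in> ?P. edges_in ?E Z = i}" for Z
      by (rule b) (use that in simp)
    show "edges_in ?E' (?V' - Z) \<le> n - k" if "Z \<in> {Z \<in> ?P'. edges_in ?E' Z = i}" for Z
      by (rule b') (use that in simp)
    show "(\<Sum>Z\<in>{Z \<in> ?P. edges_in ?E Z = i}. 1 * (real (q - 1) ^ edges_in ?E (?V - Z) *
        real q ^ (n - k - edges_in ?E (?V - Z)))) =
      (\<Sum>Z\<in>{Z \<in> ?P'. edges_in ?E' Z = i}. 1 * (real (q - 1) ^ edges_in ?E' (?V' - Z) *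
        real q ^ (n - k - edges_in ?E' (?V' - Z))))" if "q \<ge> 1" for q :: nat
      unfolding mult_1 by (rule **[OF that])
  qed
  then have "card {Z. Z \<in> {Z. Z \<in> ?P \<and> edges_in ?E Z = i} \<and> edges_in ?E (?V - Z) = j} =
      card {Z. Z \<in> {Z. Z \<in> ?P' \<and> edges_in ?E' Z = i} \<and> edges_in ?E' (?V' - Z) = j}"
    by (simp only: sum_constant mult_1_right of_nat_eq_iff)
  moreover have "{Z \<in> Pow ?V. stat ?V ?E Z = t} =
      {Z. Z \<in> {Z. Z \<in> ?P \<and> edges_in ?E Z = i} \<and> edges_in ?E (?V - Z) = j}"
    "{Z \<in> Pow ?V'. stat ?V' ?E' Z = t} =
      {Z. Z \<in> {Z. Z \<in> ?P' \<and> edges_in ?E' Z = i} \<and> edges_in ?E' (?V' - Z) = j}"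
    by (auto simp: stat_def t)
  ultimately have "card {Z \<in> Pow ?V. stat ?V ?E Z = t} = card {Z \<in> Pow ?V'. stat ?V' ?E' Z = t}"
    by presburger
  then show "count (stat_mset ?V ?E) t = count (stat_mset ?V' ?E') t"
    using fin by (simp add: stat_mset_def count_image_mset_set)
qed

section \<open>A graph with the chromatic symmetric function of a tree is a tree\<close>

lemma finite_restricted_colorings:
  "finite V \<Longrightarrow> finite (restricted_colorings V E (\<lambda>_. {1..q}))"
  unfolding restricted_colorings_def
  by (rule finite_subset[of _ "PiE V (\<lambda>_. {1..q})"]) (auto intro: finite_PiE)

lemma size_coloring_monomial: "size (coloring_monomial G \<kappa>) = card (vertices G)"
  by (simp add: coloring_monomial_def)

text \<open>Every monomial has the number of vertices as its degree, so one nonzero coefficient is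
  enough. The two proper 2-colourings of a tree provide it; for a graph with a loop the function
  would vanish and show nothing.\<close>

lemma csf_tree_card:
  assumes wf: "wf_multigraph F" "wf_multigraph T"
    and csf: "chromatic_symmetric_function F = chromatic_symmetric_function T"
    and rT: "rooted (vertices T) (set_mset (edges T)) rT parT htT"
  shows "card (vertices F) = card (vertices T)"
proof -
  let ?Q = "\<lambda>m. size m = card (vertices T)"
  have "bounded_colorings T 2 ?Q = bounded_colorings T 2 (\<lambda>_. True)"
    by (simp add: bounded_colorings_def size_coloring_monomial)
  then have "card (bounded_colorings T 2 ?Q) = 2"
    using card_uniform_colorings[OF rT, of 2] by (simp add: bounded_colorings_uniform[OF wf(2)])
  then have "bounded_colorings F 2 ?Q \<noteq> {}"
    using card_bounded_colorings_cong[OF wf csf, of 2 ?Q] by auto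
  then show ?thesis by (auto simp: bounded_colorings_def size_coloring_monomial)
qed

text \<open>The two graphs have the same numbers of proper colourings. With two colours this forces \<open>F\<close> to
  be connected (flip the colours on one component); with enough colours it excludes any edge
  \<open>xy\<close> outside a spanning tree (give \<open>x\<close> and \<open>y\<close> the same colour).\<close>

lemma csf_tree_imp_rooted:
  fixes F :: "'a multigraph" and T :: "'b multigraph"
  assumes wf: "wf_multigraph F" "wf_multigraph T"
    and csf: "chromatic_symmetric_function F = chromatic_symmetric_function T"
    and rT: "rooted (vertices T) (set_mset (edges T)) rT parT htT"
    and r: "r \<in> vertices F"
  shows "\<exists>par ht. rooted (vertices F) (set_mset (edges F)) r par ht"
proof -
  let ?V = "vertices F" and ?E = "set_mset (edges F)"
  let ?RC = "\<lambda>E q. restricted_colorings ?V E (\<lambda>_. {1..q})"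
  have fin: "finite ?V" and sub: "\<And>e. e \<in> ?E \<Longrightarrow> set_uprod e \<subseteq> ?V"
    using wf(1) by (auto simp: wf_multigraph_def)
  have count: "card (?RC ?E q) = q * (q - 1) ^ (card ?V - 1)" for q
    using card_bounded_colorings_cong[OF wf csf, of q "\<lambda>_. True"] card_uniform_colorings[OF rT, of q]
      csf_tree_card[OF wf csf rT]
    by (simp add: bounded_colorings_uniform[OF wf(1)] bounded_colorings_uniform[OF wf(2)])
  have two: "card (?RC ?E 2) = 2" using count[of 2] by simp
  then have "?RC ?E 2 \<noteq> {}" by force
  then obtain \<kappa> where \<kappa>: "\<kappa> \<in> ?RC ?E 2" by blast
  have \<kappa>_proper: "\<kappa> v \<noteq> \<kappa> w" if "Upair v w \<in> ?E" for v w
    using \<kappa> that by (simp add: restricted_colorings_def)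
  have \<kappa>_range: "\<kappa> v = 1 \<or> \<kappa> v = 2" if "v \<in> ?V" for v
    using PiE_mem[of \<kappa> ?V "\<lambda>_. {1..2}" v] \<kappa> that by (auto simp: restricted_colorings_def)
  define R where "R = {(a, b). Upair a b \<in> ?E}"
  define C where "C = {x. (r, x) \<in> R\<^sup>*}"
  have C_step: "v \<in> C \<longleftrightarrow> w \<in> C" if "Upair v w \<in> ?E" for v w
  proof -
    have "Upair w v \<in> ?E" using that by (metis Upair_inject)
    then have "(v, w) \<in> R" "(w, v) \<in> R" using that by (auto simp: R_def)
    then show ?thesis unfolding C_def by (auto intro: rtrancl_into_rtrancl)
  qed
  have conn: "x \<in> C" if x: "x \<in> ?V" for x
  proof (rule ccontr)
    assume "x \<notin> C"
    \<comment> \<open>\<open>3 - \<kappa> v\<close> swaps the colours 1 and 2. Outside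
      \<open>vertices F\<close> the default value has to stay, since colourings are
      extensional.\<close>
    define flip where "flip A = (\<lambda>v. if v \<in> ?V \<and> v \<in> A then 3 - \<kappa> v else \<kappa> v)" for A
    have flip: "flip A \<in> ?RC ?E 2" if A: "\<And>v w. Upair v w \<in> ?E \<Longrightarrow> v \<in> A \<longleftrightarrow> w \<in> A" for A
      unfolding restricted_colorings_def
    proof (intro CollectI conjI allI impI)
      show "flip A \<in> ?V \<rightarrow>\<^sub>E {1..2}"
        using \<kappa> \<kappa>_range by (force simp: flip_def restricted_colorings_def PiE_iff extensional_def)
      fix v w assume e: "Upair v w \<in> ?E"
      then have "v \<in> ?V" "w \<in> ?V" using sub[OF e] by auto
      then show "flip A v \<noteq> flip A w"
        using A[OF e] \<kappa>_proper[OF e] \<kappa>_range by (force simp: flip_def)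
    qed
    have ne: "3 - \<kappa> v \<noteq> \<kappa> v" if "v \<in> ?V" for v using \<kappa>_range[OF that] by auto
    have "r \<in> C" by (simp add: C_def)
    \<comment> \<open>Flipping nothing, the component of \<open>r\<close>, or everything gives three
      colourings, told apart at \<open>r\<close> and \<open>x\<close>, where only two are
      allowed.\<close>
    have "flip C r \<noteq> flip {} r" "flip UNIV r \<noteq> flip {} r" "flip UNIV x \<noteq> flip C x"
      using \<open>r \<in> C\<close> \<open>x \<notin> C\<close> r x ne by (auto simp: flip_def)
    then have "card {flip {}, flip C, flip UNIV} = 3" by (metis card_3_iff)
    moreover have "{flip {}, flip C, flip UNIV} \<subseteq> ?RC ?E 2" using flip C_step by auto
    ultimately have "3 \<le> card (?RC ?E 2)"
      using card_mono[OF finite_restricted_colorings[OF fin]] by metis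
    then show False using two by simp
  qed
  then have "(r, x) \<in> {(a, b). Upair a b \<in> ?E}\<^sup>*" if "x \<in> ?V" for x
    using that by (auto simp: C_def R_def)
  then obtain S par ht where S: "rooted ?V S r par ht" "S \<subseteq> ?E"
    using exists_spanning_tree[OF fin r sub] by blast
  have "S = ?E"
  proof (rule ccontr)
    assume "S \<noteq> ?E"
    then obtain x y where xy: "Upair x y \<in> ?E" "Upair x y \<notin> S"
      using S(2) by (metis subsetI subset_antisym uprod_exhaust)
    have V: "x \<in> ?V" "y \<in> ?V" using sub[OF xy(1)] by auto
    obtain g :: "'a \<Rightarrow> nat" and N where g: "g ` ?V = {i. i < N}" "inj_on g ?V"
      using finite_imp_inj_to_nat_seg[OF fin] by blast
    \<comment> \<open>All vertices get different positive colours, except that \<open>y\<close>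
      takes the colour of \<open>x\<close>. Only the edge \<open>Upair x y\<close>, which is not in
      \<open>S\<close>, is violated.\<close>
    define \<gamma> where "\<gamma> = restrict (\<lambda>v. Suc (g (if v = y then x else v))) ?V"
    have "\<gamma> \<in> ?RC S N"
      unfolding restricted_colorings_def
    proof (intro CollectI conjI allI impI)
      have "g v < N" if "v \<in> ?V" for v using g(1) that by blast
      then show "\<gamma> \<in> ?V \<rightarrow>\<^sub>E {1..N}" using V by (auto simp: \<gamma>_def Suc_le_eq)
      fix v w assume e: "Upair v w \<in> S"
      then have e': "Upair v w \<in> ?E" using S(2) by blast
      have "v \<in> ?V" "w \<in> ?V" "v \<noteq> w" using sub[OF e'] \<kappa>_proper[OF e'] by auto
      moreover have "Upair w v \<in> S" using e by (metis Upair_inject)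
      ultimately show "\<gamma> v \<noteq> \<gamma> w"
        using V xy(2) e g(2) by (auto simp: \<gamma>_def inj_on_eq_iff split: if_splits)
    qed
    moreover have "\<gamma> \<notin> ?RC ?E N"
    proof
      assume "\<gamma> \<in> ?RC ?E N"
      then have "\<gamma> x \<noteq> \<gamma> y" using xy(1) unfolding restricted_colorings_def by blast
      then show False using V by (simp add: \<gamma>_def)
    qed
    moreover have "?RC ?E N \<subseteq> ?RC S N" using S(2) by (auto simp: restricted_colorings_def)
    ultimately have "card (?RC ?E N) < card (?RC S N)"
      by (intro psubset_card_mono finite_restricted_colorings fin) auto
    then show False using count[of N] card_uniform_colorings[OF S(1), of N] by simp
  qed
  with S(1) show ?thesis by auto
qed

section \<open>Connected vertex sets\<close>

text \<open>Stated for edge sets; multiplicities return only in the final theorem.\<close>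

definition graph_iso :: "('a \<Rightarrow> 'b) \<Rightarrow> 'a set \<Rightarrow> 'a uprod set \<Rightarrow> 'b set \<Rightarrow> 'b uprod set \<Rightarrow> bool" where
  "graph_iso f V E V' E' \<longleftrightarrow> bij_betw f V V' \<and> map_uprod f ` E = E'"

definition edges_within :: "'a set \<Rightarrow> 'a uprod set \<Rightarrow> bool" where
  "edges_within V E \<longleftrightarrow> (\<forall>e\<in>E. set_uprod e \<subseteq> V)"

lemma map_uprod_inv:
  assumes "inj_on f V" "set_uprod e \<subseteq> V"
  shows "map_uprod (inv_into V f) (map_uprod f e) = e"
  using assms by (cases e) (auto simp: uprod.map_comp)

lemma map_uprod_inj_on: "inj_on f V \<Longrightarrow> edges_within V E \<Longrightarrow> inj_on (map_uprod f) E"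
  by (metis edges_within_def inj_onI map_uprod_inv)

lemma graph_iso_sym:
  assumes "graph_iso f V E V' E'" "edges_within V E"
  shows "graph_iso (inv_into V f) V' E' V E"
proof -
  have "map_uprod (inv_into V f) (map_uprod f e) = e" if "e \<in> E" for e
    using assms that by (intro map_uprod_inv) (auto simp: graph_iso_def edges_within_def bij_betw_def)
  then have "map_uprod (inv_into V f) ` map_uprod f ` E = E" by (simp add: image_image)
  then show ?thesis using assms(1) by (auto simp: graph_iso_def bij_betw_inv_into)
qed

lemma graph_iso_trans:
  assumes "graph_iso f V E V' E'" "graph_iso g V' E' V'' E''"
  shows "graph_iso (g \<circ> f) V E V'' E''"
  using assms by (auto simp: graph_iso_def uprod.map_comp[symmetric] image_image intro: bij_betw_trans)

lemma graph_iso_edges_in: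
  assumes "graph_iso f V E V' E'" "edges_within V E" "Z \<subseteq> V"
  shows "edges_in E' (f ` Z) = edges_in E Z"
proof -
  have f: "inj_on f V" "E' = map_uprod f ` E" using assms(1) by (auto simp: graph_iso_def bij_betw_def)
  have "{e \<in> E'. set_uprod e \<subseteq> f ` Z} = map_uprod f ` {e \<in> E. set_uprod e \<subseteq> Z}"
  proof -
    have "f ` set_uprod e \<subseteq> f ` Z \<longleftrightarrow> set_uprod e \<subseteq> Z" if "e \<in> E" for e
    proof
      assume *: "f ` set_uprod e \<subseteq> f ` Z"
      have "set_uprod e \<subseteq> V" using that assms(2) by (simp add: edges_within_def)
      then show "set_uprod e \<subseteq> Z" using * assms(3) f(1) by (metis inj_on_image_mem_iff image_subset_iff subset_iff)
    qed auto
    then have "set_uprod (map_uprod f e) \<subseteq> f ` Z \<longleftrightarrow> set_uprod e \<subseteq> Z" if "e \<in> E" for e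
      using that by (simp add: uprod.set_map)
    then show ?thesis unfolding f(2) by blast
  qed
  moreover have "inj_on (map_uprod f) {e \<in> E. set_uprod e \<subseteq> Z}"
    using map_uprod_inj_on[OF f(1) assms(2)] by (rule inj_on_subset) auto
  ultimately show ?thesis by (simp add: edges_in_def card_image)
qed

lemma graph_iso_stat:
  assumes "graph_iso f V E V' E'" "edges_within V E" "Z \<subseteq> V"
  shows "stat V' E' (f ` Z) = stat V E Z"
proof -
  have f: "inj_on f V" "f ` V = V'" using assms(1) by (auto simp: graph_iso_def bij_betw_def)
  then have "V' - f ` Z = f ` (V - Z)" using assms(3) by (metis inj_on_image_set_diff Diff_subset)
  then show ?thesis
    using graph_iso_edges_in[OF assms(1,2)] assms(3) card_image[OF inj_on_subset[OF f(1) assms(3)]]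
    by (simp add: stat_def)
qed

text \<open>In a forest, \<open>card Z - edges_in E Z\<close> is the number of components induced on
  \<open>Z\<close>. So for a tree these are the nonempty connected sets, in a form that can be read
  off \<open>stat\<close>.\<close>

definition conn_sets :: "'a set \<Rightarrow> 'a uprod set \<Rightarrow> 'a set set" where
  "conn_sets V E = {Z. Z \<subseteq> V \<and> card Z = Suc (edges_in E Z)}"

text \<open>For a tree and a connected \<open>Z\<close> this is the number of edges leaving \<open>Z\<close>: the forest induced
  on \<open>V - Z\<close> has one component for each of them.\<close>

definition bd :: "'a set \<Rightarrow> 'a uprod set \<Rightarrow> 'a set \<Rightarrow> nat" where
  "bd V E Z = card V - card Z - edges_in E (V - Z)"

lemma finite_conn_sets: "finite V \<Longrightarrow> finite (conn_sets V E)"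
  by (rule finite_subset[of _ "Pow V"]) (auto simp: conn_sets_def)

lemma graph_iso_conn_sets:
  assumes iso: "graph_iso f V E V' E'" and E: "edges_within V E"
  shows "bij_betw ((`) f) (conn_sets V E) (conn_sets V' E')"
    "\<And>Z. Z \<subseteq> V \<Longrightarrow> bd V' E' (f ` Z) = bd V E Z" "\<And>Z. Z \<subseteq> V \<Longrightarrow> card (f ` Z) = card Z"
proof -
  have f: "bij_betw f V V'" using iso by (simp add: graph_iso_def)
  have cV: "card V' = card V" using f by (simp add: bij_betw_same_card)
  have st: "card (f ` Z) = card Z" "edges_in E' (f ` Z) = edges_in E Z"
    "edges_in E' (V' - f ` Z) = edges_in E (V - Z)" if "Z \<subseteq> V" for Z
    using graph_iso_stat[OF iso E that] by (auto simp: stat_def)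
  show "card (f ` Z) = card Z" if "Z \<subseteq> V" for Z using st(1)[OF that] .
  show "bd V' E' (f ` Z) = bd V E Z" if "Z \<subseteq> V" for Z using st[OF that] cV by (simp add: bd_def)
  have P: "bij_betw ((`) f) (Pow V) (Pow V')" using f by (rule bij_betw_Pow)
  show "bij_betw ((`) f) (conn_sets V E) (conn_sets V' E')"
  proof (rule bij_betw_subset[OF P])
    show "conn_sets V E \<subseteq> Pow V" by (auto simp: conn_sets_def)
    show "(`) f ` conn_sets V E = conn_sets V' E'"
    proof (intro equalityI subsetI)
      fix Y assume "Y \<in> (`) f ` conn_sets V E"
      then obtain Z where Z: "Z \<in> conn_sets V E" "Y = f ` Z" by blast
      then have "Z \<subseteq> V" by (simp add: conn_sets_def)
      moreover have "f ` Z \<subseteq> V'" using \<open>Z \<subseteq> V\<close> f by (auto simp: bij_betw_def)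
      ultimately show "Y \<in> conn_sets V' E'" using st Z by (simp add: conn_sets_def)
    next
      fix Y assume Y: "Y \<in> conn_sets V' E'"
      then obtain Z where "Z \<subseteq> V" "Y = f ` Z"
        using f by (auto simp: conn_sets_def bij_betw_def subset_image_iff)
      then show "Y \<in> (`) f ` conn_sets V E" using Y st by (auto simp: conn_sets_def)
    qed
  qed
qed

lemma graph_iso_sum:
  fixes G :: "nat \<Rightarrow> nat \<Rightarrow> 'c :: comm_monoid_add"
  assumes iso: "graph_iso f V E V' E'" and E: "edges_within V E"
    and P: "\<And>Z. Z \<subseteq> V \<Longrightarrow> P' (f ` Z) \<longleftrightarrow> P Z"
  shows "(\<Sum>Z | Z \<in> conn_sets V E \<and> P Z. G (card Z) (bd V E Z)) =
    (\<Sum>Z | Z \<in> conn_sets V' E' \<and> P' Z. G (card Z) (bd V' E' Z))"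
proof -
  note iso' = graph_iso_conn_sets[OF iso E]
  have sub: "Z \<subseteq> V" if "Z \<in> conn_sets V E" for Z using that by (simp add: conn_sets_def)
  have "bij_betw ((`) f) {Z \<in> conn_sets V E. P Z} {Z \<in> conn_sets V' E'. P' Z}"
  proof (rule bij_betw_subset[OF iso'(1)])
    show "(`) f ` {Z \<in> conn_sets V E. P Z} = {Z \<in> conn_sets V' E'. P' Z}"
    proof (intro equalityI subsetI)
      fix Y assume "Y \<in> (`) f ` {Z \<in> conn_sets V E. P Z}"
      then obtain Z where "Z \<in> conn_sets V E" "P Z" "Y = f ` Z" by blast
      then show "Y \<in> {Z \<in> conn_sets V' E'. P' Z}"
        using bij_betwE[OF iso'(1)] P[OF sub] by simp
    next
      fix Y assume Y: "Y \<in> {Z \<in> conn_sets V' E'. P' Z}"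
      then obtain Z where "Z \<in> conn_sets V E" "Y = f ` Z"
        using bij_betw_imp_surj_on[OF iso'(1)] by blast
      then show "Y \<in> (`) f ` {Z \<in> conn_sets V E. P Z}" using Y P[OF sub] by blast
    qed
  qed auto
  then have "(\<Sum>Z | Z \<in> conn_sets V' E' \<and> P' Z. G (card Z) (bd V' E' Z)) =
     (\<Sum>Z | Z \<in> conn_sets V E \<and> P Z. G (card (f ` Z)) (bd V' E' (f ` Z)))"
    by (rule sum.reindex_bij_betw[symmetric])
  also have "\<dots> = (\<Sum>Z | Z \<in> conn_sets V E \<and> P Z. G (card Z) (bd V E Z))"
    using iso'(2,3) sub by (intro sum.cong) auto
  finally show ?thesis by simp
qed

text \<open>Membership in \<open>conn_sets\<close> and the value of \<open>bd\<close> are functions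
  of \<open>stat\<close>, so the sum may run over all subsets, with the disconnected ones
  contributing 0.\<close>

lemma sum_conn_sets_stat:
  fixes G :: "nat \<Rightarrow> nat \<Rightarrow> 'c :: comm_monoid_add"
  assumes "finite V"
  shows "(\<Sum>Z\<in>conn_sets V E. G (card Z) (bd V E Z)) =
    (\<Sum>(k, i, j)\<in>#stat_mset V E. if k = Suc i then G k (card V - k - j) else 0)"
proof -
  define g where "g = (\<lambda>(k, i, j). if k = Suc i then G k (card V - k - j) else 0)"
  have "(\<Sum>t\<in>#stat_mset V E. g t) = (\<Sum>Z\<in>Pow V. g (stat V E Z))"
    by (simp only: stat_mset_def image_mset.compositionality o_def sum_unfold_sum_mset)
  also have "\<dots> = (\<Sum>Z\<in>conn_sets V E. g (stat V E Z))"
  proof (rule sum.mono_neutral_right)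
    show "\<forall>Z\<in>Pow V - conn_sets V E. g (stat V E Z) = 0"
      unfolding conn_sets_def g_def stat_def prod.case by simp
    show "finite (Pow V)" using assms by simp
    show "conn_sets V E \<subseteq> Pow V" by (simp add: conn_sets_def subset_eq)
  qed
  also have "\<dots> = (\<Sum>Z\<in>conn_sets V E. G (card Z) (bd V E Z))"
  proof (rule sum.cong[OF refl])
    fix Z assume "Z \<in> conn_sets V E"
    then have "card Z = Suc (edges_in E Z)" by (simp add: conn_sets_def)
    then show "g (stat V E Z) = G (card Z) (bd V E Z)"
      unfolding g_def stat_def bd_def prod.case by (rule if_P)
  qed
  finally show ?thesis unfolding g_def by (rule sym)
qed

lemma stat_mset_sum:
  fixes G :: "nat \<Rightarrow> nat \<Rightarrow> 'c :: comm_monoid_add"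
  assumes "finite V" "finite V'" "stat_mset V E = stat_mset V' E'" "card V = card V'"
  shows "(\<Sum>Z\<in>conn_sets V E. G (card Z) (bd V E Z)) = (\<Sum>Z\<in>conn_sets V' E'. G (card Z) (bd V' E' Z))"
  unfolding sum_conn_sets_stat[OF assms(1)] sum_conn_sets_stat[OF assms(2)] assms(3,4) ..

text \<open>The edges inside \<open>Z\<close> belong to the nonroot vertices whose parent is also in
  \<open>Z\<close>. There are \<open>card Z - 1\<close> of them only if all nonroot vertices of
  \<open>Z\<close> qualify.\<close>

lemma rooted_conn_sets_iff:
  assumes rt: "rooted V E r par ht" and Z: "Z \<subseteq> V" "r \<in> Z"
  shows "Z \<in> conn_sets V E \<longleftrightarrow> (\<forall>x\<in>Z. x \<noteq> r \<longrightarrow> par x \<in> Z)"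
proof -
  have fin: "finite Z" using Z rootedD(1)[OF rt] finite_subset by blast
  let ?A = "{x \<in> Z. x \<noteq> r \<and> par x \<in> Z}"
  have "card (Z - {r}) = card Z - 1" "card Z > 0" using fin Z(2) by (auto simp: card_gt_0_iff)
  then have "Z \<in> conn_sets V E \<longleftrightarrow> card ?A = card (Z - {r})"
    unfolding conn_sets_def mem_Collect_eq rooted_edges_in[OF rt Z(1)] using Z(1) by linarith
  also have "\<dots> \<longleftrightarrow> ?A = Z - {r}"
  proof
    assume "card ?A = card (Z - {r})"
    with fin show "?A = Z - {r}" by (intro card_subset_eq) auto
  qed (rule arg_cong)
  also have "\<dots> \<longleftrightarrow> (\<forall>x\<in>Z. x \<noteq> r \<longrightarrow> par x \<in> Z)" by auto
  finally show ?thesis .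
qed

text \<open>A vertex outside \<open>Z\<close> is not the root; its parent is outside too, which
  gives an edge inside \<open>V - Z\<close>, or in \<open>Z\<close>, which gives an edge leaving
  \<open>Z\<close>.\<close>

lemma rooted_bd:
  assumes rt: "rooted V E r par ht" and Z: "Z \<subseteq> V" "r \<in> Z"
  shows "bd V E Z = card {y \<in> V - Z. par y \<in> Z}"
proof -
  have fin: "finite V" using rootedD(1)[OF rt] .
  have "V - Z = {x \<in> V - Z. x \<noteq> r \<and> par x \<in> V - Z} \<union> {y \<in> V - Z. par y \<in> Z}"
    using Z rootedD(4)[OF rt] by blast
  then have "card (V - Z) = card ({x \<in> V - Z. x \<noteq> r \<and> par x \<in> V - Z} \<union> {y \<in> V - Z. par y \<in> Z})"
    by (rule arg_cong)
  also have "\<dots> = edges_in E (V - Z) + card {y \<in> V - Z. par y \<in> Z}"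
    using fin by (subst card_Un_disjoint) (auto simp: rooted_edges_in[OF rt])
  finally show ?thesis
    using card_Diff_subset[OF finite_subset[OF Z(1) fin] Z(1)] by (simp add: bd_def)
qed

text \<open>Each vertex of \<open>Z\<close> has at most one child, and \<open>card Z - 1\<close> of
  these children lie in \<open>Z\<close>, so at most one edge leaves \<open>Z\<close> downwards. The
  edge going up from the top of \<open>Z\<close> is the second one; in the count it appears as the
  root, the only vertex outside \<open>Z\<close> that has no edge to a parent.\<close>

lemma rooted_bd_le_2:
  assumes rt: "rooted V E r par ht" and Z: "Z \<in> conn_sets V E" "r \<notin> Z"
    and inj: "\<And>x y. x \<in> V \<Longrightarrow> y \<in> V \<Longrightarrow> x \<noteq> r \<Longrightarrow> y \<noteq> r \<Longrightarrow> par x \<in> Z \<Longrightarrow> par x = par y \<Longrightarrow> x = y"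
  shows "bd V E Z \<le> 2"
proof -
  have fin: "finite V" using rootedD(1)[OF rt] .
  have ZV: "Z \<subseteq> V" using Z by (simp add: conn_sets_def)
  let ?out = "{y \<in> V - Z. y \<noteq> r \<and> par y \<in> Z}" and ?inn = "{y \<in> Z. y \<noteq> r \<and> par y \<in> Z}"
  have finZ: "finite Z" using ZV fin finite_subset by blast
  have "card (?out \<union> ?inn) \<le> card Z"
  proof (rule card_inj_on_le[OF _ _ finZ])
    show "inj_on par (?out \<union> ?inn)" by (rule inj_onI, rule inj) (use ZV in auto)
  qed auto
  moreover have "card (?out \<union> ?inn) = card ?out + card ?inn"
    using fin finZ by (intro card_Un_disjoint) auto
  moreover have "card Z = Suc (card ?inn)"
    using Z rooted_edges_in[OF rt ZV] by (simp add: conn_sets_def)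
  ultimately have out: "card ?out \<le> 1" by simp
  have "V - Z \<subseteq> {x \<in> V - Z. x \<noteq> r \<and> par x \<in> V - Z} \<union> ?out \<union> {r}"
    using rootedD(4)[OF rt] by blast
  then have "card (V - Z) \<le> card ({x \<in> V - Z. x \<noteq> r \<and> par x \<in> V - Z} \<union> ?out \<union> {r})"
    using fin by (intro card_mono) auto
  also have "\<dots> \<le> edges_in E (V - Z) + card ?out + 1"
    using card_Un_le[of "{x \<in> V - Z. x \<noteq> r \<and> par x \<in> V - Z} \<union> ?out" "{r}"]
      card_Un_le[of "{x \<in> V - Z. x \<noteq> r \<and> par x \<in> V - Z}" ?out]
    by (simp add: rooted_edges_in[OF rt])
  finally show ?thesis using out ZV fin finZ by (simp add: bd_def card_Diff_subset)
qed

text \<open>The hypothesis on degrees is thereby expressed by a quantity that \<open>stat\<close>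
  controls. A tree has \<open>card V - 1\<close> edges, and those that miss \<open>x\<close> lie
  inside \<open>V - {x}\<close>.\<close>

lemma vertex_degree_eq_bd:
  assumes rt: "rooted (vertices G) (set_mset (edges G)) r par ht"
    and simple: "edges G = mset_set (set_mset (edges G))" and x: "x \<in> vertices G"
  shows "vertex_degree G x = bd (vertices G) (set_mset (edges G)) {x}"
proof -
  let ?V = "vertices G" and ?E = "set_mset (edges G)"
  have fin: "finite ?V" "finite ?E" using rootedD(1)[OF rt] by auto
  have noloop: "Upair y y \<notin> ?E" for y
  proof
    assume "Upair y y \<in> ?E"
    then obtain z where "z \<in> ?V" "z \<noteq> r" "Upair y y = Upair z (par z)" using rootedD(6)[OF rt] by blast
    then show False using rootedD(5)[OF rt, of z] by auto
  qed
  have "{#e \<in># edges G. x \<in> set_uprod e#} = mset_set {e \<in> ?E. x \<in> set_uprod e}"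
    by (subst simple, rule filter_mset_mset_set) simp
  moreover have "{#e \<in># edges G. e = Upair x x#} = {#}" using noloop by (subst set_mset_eq_empty_iff[symmetric]) auto
  ultimately have "vertex_degree G x = card {e \<in> ?E. x \<in> set_uprod e}" by (simp add: vertex_degree_def)
  moreover have "card ?E = card {e \<in> ?E. x \<in> set_uprod e} + edges_in ?E (?V - {x})"
  proof -
    have "?E = {e \<in> ?E. x \<in> set_uprod e} \<union> {e \<in> ?E. set_uprod e \<subseteq> ?V - {x}}"
      using rooted_edge_subset[OF rt] by blast
    then have "card ?E = card ({e \<in> ?E. x \<in> set_uprod e} \<union> {e \<in> ?E. set_uprod e \<subseteq> ?V - {x}})" by (rule arg_cong)
    also have "\<dots> = card {e \<in> ?E. x \<in> set_uprod e} + edges_in ?E (?V - {x})"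
      unfolding edges_in_def by (rule card_Un_disjoint) (use fin in auto)
    finally show ?thesis .
  qed
  ultimately show "vertex_degree G x = bd ?V ?E {x}"
    using rooted_card_edges[OF rt] by (simp add: bd_def)
qed

section \<open>Spiders with two hubs\<close>

datatype 'i spider_vertex = C nat | L 'i nat

text \<open>The central path is \<open>C 0, \<dots>, C d\<close>; leg \<open>i\<close> is \<open>L i 0, \<dots>, L i (l i - 1)\<close>, attached to \<open>C 0\<close> if
  \<open>h i\<close> and to \<open>C d\<close> otherwise.\<close>

definition spider_verts :: "'i set \<Rightarrow> ('i \<Rightarrow> nat) \<Rightarrow> nat \<Rightarrow> 'i spider_vertex set" where
  "spider_verts I l d = C ` {..d} \<union> (\<Union>i\<in>I. L i ` {..<l i})"

fun spider_par :: "nat \<Rightarrow> ('i \<Rightarrow> bool) \<Rightarrow> 'i spider_vertex \<Rightarrow> 'i spider_vertex" where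
  "spider_par d h (C j) = C (j - 1)"
| "spider_par d h (L i j) = (if j = 0 then C (if h i then 0 else d) else L i (j - 1))"

definition spider_edges :: "'i set \<Rightarrow> ('i \<Rightarrow> nat) \<Rightarrow> nat \<Rightarrow> ('i \<Rightarrow> bool) \<Rightarrow> 'i spider_vertex uprod set" where
  "spider_edges I l d h = (\<lambda>x. Upair x (spider_par d h x)) ` (spider_verts I l d - {C 0})"

fun spider_ht :: "nat \<Rightarrow> ('i \<Rightarrow> bool) \<Rightarrow> 'i spider_vertex \<Rightarrow> nat" where
  "spider_ht d h (C j) = j"
| "spider_ht d h (L i j) = Suc ((if h i then 0 else d) + j)"

lemma spider_verts_iff [simp]:
  "C j \<in> spider_verts I l d \<longleftrightarrow> j \<le> d"
  "L i j \<in> spider_verts I l d \<longleftrightarrow> i \<in> I \<and> j < l i"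
  by (auto simp: spider_verts_def)

lemma finite_spider_verts: "finite I \<Longrightarrow> finite (spider_verts I l d)"
  by (auto simp: spider_verts_def)

lemma spider_rooted:
  assumes "finite I"
  shows "rooted (spider_verts I l d) (spider_edges I l d h) (C 0) (spider_par d h) (spider_ht d h)"
proof -
  have "spider_par d h x \<in> spider_verts I l d \<and> spider_ht d h x = Suc (spider_ht d h (spider_par d h x))"
    if "x \<in> spider_verts I l d - {C 0}" for x
    using that by (cases x) (auto split: if_splits)
  then show ?thesis
    using assms by (simp add: rooted_def finite_spider_verts spider_edges_def)
qed

lemma rooted_graph_iso:
  assumes "rooted V E r par ht" "rooted V' E' r' par' ht'"
    and f: "bij_betw f V V'" "f r = r'" "\<And>x. x \<in> V \<Longrightarrow> x \<noteq> r \<Longrightarrow> f (par x) = par' (f x)"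
  shows "graph_iso f V E V' E'"
proof -
  have "f ` (V - {r}) = f ` V - f ` {r}"
    using f(1) rootedD(2)[OF assms(1)] by (intro inj_on_image_set_diff[of f V]) (auto simp: bij_betw_def)
  then have "f ` (V - {r}) = V' - {r'}" using f(1,2) by (simp add: bij_betw_def)
  then have "E' = (\<lambda>x. Upair (f x) (par' (f x))) ` (V - {r})"
    unfolding rootedD(6)[OF assms(2)] by (simp only: image_image flip: \<open>f ` (V - {r}) = V' - {r'}\<close>)
  also have "\<dots> = (\<lambda>x. map_uprod f (Upair x (par x))) ` (V - {r})"
    using f(3) by (intro image_cong) auto
  also have "\<dots> = map_uprod f ` E"
    unfolding rootedD(6)[OF assms(1)] by (rule image_image[symmetric])
  finally show ?thesis using f(1) by (simp add: graph_iso_def)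
qed

fun spider_swap :: "nat \<Rightarrow> 'i spider_vertex \<Rightarrow> 'i spider_vertex" where
  "spider_swap d (C j) = C (d - j)"
| "spider_swap d (L i j) = L i j"

text \<open>Reversing the central path exchanges the hubs, hence negates \<open>h\<close>. It moves
  the root and so does not respect parents: the edge from \<open>C j\<close> to its parent becomes
  the edge from \<open>C (d - j + 1)\<close> to its parent. As the map is an involution, one
  inclusion, shown for every attachment \<open>g\<close>, suffices.\<close>

lemma spider_swap_iso:
  "graph_iso (spider_swap d) (spider_verts I l d) (spider_edges I l d h)
     (spider_verts I l d) (spider_edges I l d (\<lambda>i. \<not> h i))"
proof -
  let ?V = "spider_verts I l d"
  have invol: "spider_swap d (spider_swap d x) = x" if "x \<in> ?V" for x
    using that by (cases x) auto
  have mem: "spider_swap d x \<in> ?V" if "x \<in> ?V" for x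
    using that by (cases x) auto
  have bij: "bij_betw (spider_swap d) ?V ?V"
    by (rule bij_betw_byWitness[where f' = "spider_swap d"]) (use invol mem in auto)
  have sub: "map_uprod (spider_swap d) ` spider_edges I l d g \<subseteq> spider_edges I l d (\<lambda>i. \<not> g i)" for g
  proof clarify
    fix e assume "e \<in> spider_edges I l d g"
    then obtain x where x: "x \<in> ?V" "x \<noteq> C 0" "e = Upair x (spider_par d g x)"
      by (auto simp: spider_edges_def)
    show "map_uprod (spider_swap d) e \<in> spider_edges I l d (\<lambda>i. \<not> g i)"
    proof (cases x)
      case (C j)
      then have "0 < j" "j \<le> d" using x by auto
      then have "map_uprod (spider_swap d) e = Upair (C (Suc d - j)) (spider_par d (\<lambda>i. \<not> g i) (C (Suc d - j)))"
        using x C by (simp add: Suc_diff_le)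
      then show ?thesis using \<open>0 < j\<close> \<open>j \<le> d\<close> unfolding spider_edges_def by (intro image_eqI) auto
    next
      case (L i j)
      then have "map_uprod (spider_swap d) e = Upair x (spider_par d (\<lambda>i. \<not> g i) x)"
        using x by auto
      then show ?thesis using x unfolding spider_edges_def by (intro image_eqI) auto
    qed
  qed
  have within: "set_uprod e \<subseteq> ?V" if e: "e \<in> spider_edges I l d g" for e g
  proof -
    obtain x where "x \<in> ?V" "e = Upair x (spider_par d g x)" using e unfolding spider_edges_def by blast
    then show ?thesis by (cases x) auto
  qed
  have "spider_edges I l d (\<lambda>i. \<not> h i) \<subseteq> map_uprod (spider_swap d) ` spider_edges I l d h"
  proof
    fix e assume e: "e \<in> spider_edges I l d (\<lambda>i. \<not> h i)"
    have "map_uprod (spider_swap d) (map_uprod (spider_swap d) e) = e"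
    proof (cases e)
      case (Upair a b)
      then have "a \<in> ?V" "b \<in> ?V" using within[OF e] by auto
      then show ?thesis using Upair invol by simp
    qed
    moreover have "map_uprod (spider_swap d) e \<in> spider_edges I l d h"
      using subsetD[OF sub imageI[OF e]] by simp
    ultimately show "e \<in> map_uprod (spider_swap d) ` spider_edges I l d h" by (metis imageI)
  qed
  then show ?thesis using bij sub[of h] by (simp add: graph_iso_def subset_antisym)
qed

fun spider_relabel :: "('i \<Rightarrow> 'j) \<Rightarrow> 'i spider_vertex \<Rightarrow> 'j spider_vertex" where
  "spider_relabel \<sigma> (C j) = C j"
| "spider_relabel \<sigma> (L i j) = L (\<sigma> i) j"

lemma spider_relabel_iso:
  assumes fin: "finite I" "finite I'" and \<sigma>: "bij_betw \<sigma> I I'"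
    and l: "\<And>i. i \<in> I \<Longrightarrow> l' (\<sigma> i) = l i" and h: "\<And>i. i \<in> I \<Longrightarrow> h' (\<sigma> i) = h i"
  shows "graph_iso (spider_relabel \<sigma>) (spider_verts I l d) (spider_edges I l d h)
     (spider_verts I' l' d) (spider_edges I' l' d h')"
proof (rule rooted_graph_iso[OF spider_rooted[OF fin(1)] spider_rooted[OF fin(2)]])
  have \<sigma>': "\<sigma> i \<in> I'" "inv_into I \<sigma> (\<sigma> i) = i" if "i \<in> I" for i
    using \<sigma> that by (auto simp: bij_betw_def)
  have \<tau>: "inv_into I \<sigma> i \<in> I" "\<sigma> (inv_into I \<sigma> i) = i" if "i \<in> I'" for i
    using \<sigma> that by (auto simp: bij_betw_def inv_into_into f_inv_into_f)
  show "bij_betw (spider_relabel \<sigma>) (spider_verts I l d) (spider_verts I' l' d)"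
  proof (rule bij_betw_byWitness[where f' = "spider_relabel (inv_into I \<sigma>)"])
    show "\<forall>a\<in>spider_verts I l d. spider_relabel (inv_into I \<sigma>) (spider_relabel \<sigma> a) = a"
    proof
      fix a assume "a \<in> spider_verts I l d"
      then show "spider_relabel (inv_into I \<sigma>) (spider_relabel \<sigma> a) = a" using \<sigma>' by (cases a) auto
    qed
    show "\<forall>a\<in>spider_verts I' l' d. spider_relabel \<sigma> (spider_relabel (inv_into I \<sigma>) a) = a"
    proof
      fix a assume "a \<in> spider_verts I' l' d"
      then show "spider_relabel \<sigma> (spider_relabel (inv_into I \<sigma>) a) = a" using \<tau> by (cases a) auto
    qed
    show "spider_relabel \<sigma> ` spider_verts I l d \<subseteq> spider_verts I' l' d"
    proof clarify
      fix a assume "a \<in> spider_verts I l d"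
      then show "spider_relabel \<sigma> a \<in> spider_verts I' l' d" using \<sigma>' l by (cases a) auto
    qed
    show "spider_relabel (inv_into I \<sigma>) ` spider_verts I' l' d \<subseteq> spider_verts I l d"
    proof clarify
      fix a assume "a \<in> spider_verts I' l' d"
      then show "spider_relabel (inv_into I \<sigma>) a \<in> spider_verts I l d"
      proof (cases a)
        case (L i j)
        then have "i \<in> I'" "j < l' i" using \<open>a \<in> _\<close> by auto
        then show ?thesis using \<tau>[of i] l[of "inv_into I \<sigma> i"] L by simp
      qed simp
    qed
  qed
  show "spider_relabel \<sigma> (C 0) = C 0" by simp
  show "spider_relabel \<sigma> (spider_par d h x) = spider_par d h' (spider_relabel \<sigma> x)"
    if "x \<in> spider_verts I l d" for x
    using that h by (cases x) auto
qed

text \<open>\<open>A\<close> consists of \<open>x\<close> and its ancestors, one at each height. For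
  \<open>x = v\<close> it becomes the central path.\<close>

lemma rooted_central_path:
  assumes rt: "rooted V E u par ht" and "x \<in> V"
  shows "\<exists>A\<subseteq>V. u \<in> A \<and> x \<in> A \<and> (\<forall>y\<in>A. y \<noteq> u \<longrightarrow> par y \<in> A) \<and> bij_betw ht A {..ht x}"
  using \<open>x \<in> V\<close>
proof (induction "ht x" arbitrary: x)
  case 0
  then have "x = u" using rootedD(5)[OF rt, of x] by fastforce
  then show ?case using 0 by (intro exI[of _ "{u}"]) (auto simp: bij_betw_def)
next
  case (Suc k)
  have xu: "x \<noteq> u" using Suc.hyps(2) rootedD(3)[OF rt] by auto
  then have px: "par x \<in> V" "ht x = Suc (ht (par x))" using rootedD(4,5)[OF rt] Suc.prems by auto
  then obtain A where A: "A \<subseteq> V" "u \<in> A" "par x \<in> A" "\<forall>y\<in>A. y \<noteq> u \<longrightarrow> par y \<in> A" "bij_betw ht A {..ht (par x)}"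
    using Suc.hyps by (metis Suc_inject)
  have "x \<notin> A"
  proof
    assume "x \<in> A"
    then have "ht x \<in> {..ht (par x)}" using bij_betwE[OF A(5)] by blast
    then show False using px(2) by simp
  qed
  moreover have "ht x \<notin> {..ht (par x)}" using px(2) by auto
  ultimately have "bij_betw ht (A \<union> {x}) ({..ht (par x)} \<union> {ht x})"
    using A(5) by (rule notIn_Un_bij_betw)
  moreover have "{..ht (par x)} \<union> {ht x} = {..ht x}" using px(2) by auto
  ultimately show ?case using A Suc.prems by (intro exI[of _ "A \<union> {x}"]) auto
qed

text \<open>Coordinates on a part \<open>W\<close> of the tree that is to grow. A leg is named by
  its vertex next to the hub; as \<open>I \<subseteq> W\<close>, a vertex outside \<open>W\<close>
  is a fresh name.\<close>

definition spider_coords ::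
  "'a set \<Rightarrow> 'a \<Rightarrow> 'a \<Rightarrow> ('a \<Rightarrow> 'a) \<Rightarrow> nat \<Rightarrow> ('a \<Rightarrow> 'a spider_vertex) \<Rightarrow> 'a set \<Rightarrow> ('a \<Rightarrow> nat) \<Rightarrow> ('a \<Rightarrow> bool) \<Rightarrow> bool"
  where "spider_coords W u v par d f I l h \<longleftrightarrow> I \<subseteq> W \<and> (\<forall>i\<in>I. l i > 0) \<and>
     bij_betw f W (spider_verts I l d) \<and> f u = C 0 \<and> f v = C d \<and>
     (\<forall>x\<in>W. x \<noteq> u \<longrightarrow> f (par x) = spider_par d h (f x))"

text \<open>If the parent of \<open>x\<close> is a hub, \<open>x\<close> starts a leg. Otherwise the
  parent has no child in \<open>W\<close> yet, as it may have only one, so it is the end of a leg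
  and \<open>x\<close> prolongs that leg.\<close>

lemma spider_coords_extend:
  assumes rt: "rooted V E u par ht" and uv: "u \<in> W" "v \<in> W" "u \<noteq> v"
    and child: "\<And>x y. x \<in> V \<Longrightarrow> y \<in> V \<Longrightarrow> x \<noteq> u \<Longrightarrow> y \<noteq> u \<Longrightarrow> par x = par y \<Longrightarrow> par x \<notin> {u, v} \<Longrightarrow> x = y"
    and W: "W \<subseteq> V" "\<And>y. y \<in> W \<Longrightarrow> y \<noteq> u \<Longrightarrow> par y \<in> W"
    and co: "spider_coords W u v par d f I l h"
    and x: "x \<in> V" "x \<notin> W" "par x \<in> W"
  shows "\<exists>f' I' l' h'. spider_coords (insert x W) u v par d f' I' l' h'"
proof -
  have I: "I \<subseteq> W" "\<And>i. i \<in> I \<Longrightarrow> l i > 0" and bij: "bij_betw f W (spider_verts I l d)"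
    and f: "f u = C 0" "f v = C d" "\<And>y. y \<in> W \<Longrightarrow> y \<noteq> u \<Longrightarrow> f (par y) = spider_par d h (f y)"
    using co by (auto simp: spider_coords_def)
  have inj: "inj_on f W" and im: "f ` W = spider_verts I l d" using bij by (auto simp: bij_betw_def)
  have "x \<noteq> u" "x \<noteq> v" using uv x by auto
  have ext: "bij_betw (f(x := z)) (insert x W) (insert z (spider_verts I l d))"
    if "z \<notin> spider_verts I l d" for z
  proof -
    have "bij_betw (f(x := z)) W (spider_verts I l d)"
      using bij x(2) by (subst bij_betw_cong[of _ _ f]) auto
    then show ?thesis using notIn_Un_bij_betw[of x W "f(x := z)" "spider_verts I l d"] x(2) that by simp
  qed
  have no_child: False if "y \<in> W" "y \<noteq> u" "f (par y) = f (par x)" "par x \<notin> {u, v}" for y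
  proof -
    have "par y = par x" using inj_onD[OF inj that(3) W(2)[OF that(1,2)] x(3)] .
    then have "x = y" using child[of x y] x(1) \<open>x \<noteq> u\<close> that W(1) by auto
    then show False using that(1) x(2) by simp
  qed
  show ?thesis
  proof (cases "par x \<in> {u, v}")
    case True
    have xI: "x \<notin> I" using I(1) x(2) by blast
    let ?l = "l(x := 1)" and ?h = "h(x := (par x = u))" and ?f = "f(x := L x 0)"
    have "spider_verts (insert x I) ?l d = insert (L x 0) (spider_verts I l d)"
    proof (rule set_eqI)
      fix z show "z \<in> spider_verts (insert x I) ?l d \<longleftrightarrow> z \<in> insert (L x 0) (spider_verts I l d)"
        using xI by (cases z) (auto split: if_splits)
    qed
    moreover have "?f (par y) = spider_par d ?h (?f y)" if "y \<in> insert x W" "y \<noteq> u" for y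
    proof (cases "y = x")
      case True
      have "par x \<noteq> x" using x(2,3) by auto
      then show ?thesis using True \<open>par x \<in> {u, v}\<close> f(1,2) uv(3) by auto
    next
      case False
      then have y: "y \<in> W" "par y \<in> W" using that W(2) by auto
      then have "f y \<in> spider_verts I l d" using im by blast
      then have "spider_par d ?h (f y) = spider_par d h (f y)" using xI by (cases "f y") auto
      then show ?thesis using f(3)[OF y(1) that(2)] False y(2) x(2) by auto
    qed
    ultimately have "spider_coords (insert x W) u v par d ?f (insert x I) ?l ?h"
      unfolding spider_coords_def using ext[of "L x 0"] xI I f(1,2) \<open>x \<noteq> u\<close> \<open>x \<noteq> v\<close> by auto
    then show ?thesis by blast
  next
    case False
    have "f (par x) \<in> spider_verts I l d" using im x(3) by blast
    \<comment> \<open>An inner vertex of the central path, or a vertex of a leg before its last,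
      already has its successor in \<open>W\<close> as a child, and \<open>no_child\<close> rules
      that out.\<close>
    then have "\<exists>i\<in>I. Suc (l i) = Suc (Suc (l i - 1)) \<and> f (par x) = L i (l i - 1)"
    proof (cases "f (par x)")
      case (C j)
      have "j \<le> d" using \<open>f (par x) \<in> _\<close> C by simp
      moreover have "j \<noteq> d" using inj_onD[OF inj _ x(3) uv(2)] f(2) C False by auto
      ultimately have "C (Suc j) \<in> f ` W" using im by simp
      then obtain y where y: "y \<in> W" "f y = C (Suc j)" by force
      then have "y \<noteq> u" using f(1) by auto
      then show ?thesis using no_child[OF y(1) _ _ False] f(3)[OF y(1)] y(2) C by simp
    next
      case (L i j)
      then have ij: "i \<in> I" "j < l i" using \<open>f (par x) \<in> _\<close> by auto
      have "\<not> Suc j < l i"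
      proof
        assume "Suc j < l i"
        then have "L i (Suc j) \<in> f ` W" using im ij by simp
        then obtain y where y: "y \<in> W" "f y = L i (Suc j)" by force
        then have "y \<noteq> u" using f(1) by auto
        then show False using no_child[OF y(1) _ _ False] f(3)[OF y(1)] y(2) L by simp
      qed
      then show ?thesis using ij L by (intro bexI[of _ i]) auto
    qed
    then obtain i where i: "i \<in> I" "f (par x) = L i (l i - 1)" by blast
    let ?l = "l(i := Suc (l i))" and ?f = "f(x := L i (l i))"
    have "spider_verts I ?l d = insert (L i (l i)) (spider_verts I l d)"
    proof (rule set_eqI)
      fix z show "z \<in> spider_verts I ?l d \<longleftrightarrow> z \<in> insert (L i (l i)) (spider_verts I l d)"
        using i(1) by (cases z) (auto simp: less_Suc_eq split: if_splits)
    qed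
    moreover have "?f (par y) = spider_par d h (?f y)" if "y \<in> insert x W" "y \<noteq> u" for y
    proof (cases "y = x")
      case True
      have "par x \<noteq> x" using x(2,3) by auto
      then show ?thesis using True i I(2)[OF i(1)] by auto
    next
      case False
      then have y: "y \<in> W" "par y \<in> W" using that W(2) by auto
      then show ?thesis using f(3)[OF y(1) that(2)] False y(2) x(2) by auto
    qed
    ultimately have "spider_coords (insert x W) u v par d ?f I ?l h"
      unfolding spider_coords_def using ext[of "L i (l i)"] I f(1,2) \<open>x \<noteq> u\<close> \<open>x \<noteq> v\<close> by auto
    then show ?thesis by blast
  qed
qed

text \<open>Starting from the central path without legs, vertices are added in order of height, so
  that each finds its parent already in place.\<close>

lemma exists_spider_coords:
  assumes rt: "rooted V E u par ht" and v: "v \<in> V" "u \<noteq> v"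
    and child: "\<And>x y. x \<in> V \<Longrightarrow> y \<in> V \<Longrightarrow> x \<noteq> u \<Longrightarrow> y \<noteq> u \<Longrightarrow> par x = par y \<Longrightarrow> par x \<notin> {u, v} \<Longrightarrow> x = y"
  shows "\<exists>f I l h. spider_coords V u v par (ht v) f I l h"
proof -
  have fin: "finite V" using rootedD(1)[OF rt] .
  have grow: "\<exists>f I l h. spider_coords V u v par (ht v) f I l h"
    if "W \<subseteq> V" "u \<in> W" "v \<in> W" "\<And>y. y \<in> W \<Longrightarrow> y \<noteq> u \<Longrightarrow> par y \<in> W"
      "\<exists>f I l h. spider_coords W u v par (ht v) f I l h" for W
    using that
  proof (induction "card (V - W)" arbitrary: W)
    case 0
    then have "W = V" using fin by auto
    then show ?case using 0 by simp
  next
    case (Suc k)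
    have "V - W \<noteq> {}" using Suc.hyps(2) by (metis card.empty nat.distinct(1))
    then have "Min (ht ` (V - W)) \<in> ht ` (V - W)" using fin by (intro Min_in) auto
    then obtain x where x: "x \<in> V - W" "ht x = Min (ht ` (V - W))" by auto
    then have min: "ht x \<le> ht y" if "y \<in> V - W" for y using fin that by simp
    have "x \<noteq> u" using x Suc.prems by auto
    have "par x \<in> V" "\<not> ht x \<le> ht (par x)" using rootedD(4,5)[OF rt, of x] x(1) \<open>x \<noteq> u\<close> by auto
    then have "par x \<in> W" using min[of "par x"] by blast
    moreover obtain f I l h where "spider_coords W u v par (ht v) f I l h" using Suc.prems(5) by blast
    ultimately have "\<exists>f I l h. spider_coords (insert x W) u v par (ht v) f I l h"
      using x(1) by (intro spider_coords_extend[OF rt Suc.prems(2,3) v(2) child Suc.prems(1,4)]) auto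
    moreover have "card (V - insert x W) = k"
      using Suc.hyps(2) x(1) fin by (metis Diff_insert card_Diff_singleton diff_Suc_1)
    moreover have "par y \<in> insert x W" if "y \<in> insert x W" "y \<noteq> u" for y
      using that Suc.prems(4)[of y] \<open>par x \<in> W\<close> by blast
    ultimately show ?case using x Suc.prems(1-3)
      by (intro Suc.hyps(1)[of "insert x W"]) simp_all
  qed
  obtain A where A: "A \<subseteq> V" "u \<in> A" "v \<in> A" "\<forall>y\<in>A. y \<noteq> u \<longrightarrow> par y \<in> A" "bij_betw ht A {..ht v}"
    using rooted_central_path[OF rt v(1)] by blast
  have "bij_betw C {..ht v} (C ` {..ht v})" by (simp add: bij_betw_def inj_on_def)
  then have "bij_betw (C \<circ> ht) A (spider_verts {} (\<lambda>_. 0) (ht v))"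
    using bij_betw_trans[OF A(5)] by (simp add: spider_verts_def)
  moreover have "ht (par y) = ht y - 1" if "y \<in> A" "y \<noteq> u" for y
    using rootedD(5)[OF rt, of y] that A(1) by auto
  ultimately have "spider_coords A u v par (ht v) (C \<circ> ht) {} (\<lambda>_. 0) (\<lambda>_. True)"
    using rootedD(3)[OF rt] by (simp add: spider_coords_def)
  then show ?thesis using A by (intro grow[of A]) blast+
qed

section \<open>Generating functions of spiders\<close>

definition prefix_set :: "nat \<Rightarrow> 'i set \<Rightarrow> ('i \<Rightarrow> nat) \<Rightarrow> 'i spider_vertex set" where
  "prefix_set c J k = C ` {..c} \<union> (\<Union>i\<in>J. L i ` {..<k i})"

lemma prefix_set_iff [simp]:
  "C j \<in> prefix_set c J k \<longleftrightarrow> j \<le> c" "L i j \<in> prefix_set c J k \<longleftrightarrow> i \<in> J \<and> j < k i"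
  by (auto simp: prefix_set_def)

lemma card_prefix_set:
  fixes J :: "'i set"
  assumes "finite J"
  shows "card (prefix_set c J k) = Suc c + (\<Sum>i\<in>J. k i)"
proof -
  have "card (\<Union>i\<in>J. L i ` {..<k i}) = (\<Sum>i\<in>J. card (L i ` {..<k i}))"
    by (rule card_UN_disjoint) (use assms in auto)
  also have "\<dots> = (\<Sum>i\<in>J. k i)" by (intro sum.cong refl) (simp add: card_image inj_on_def)
  finally have "card (\<Union>i\<in>J. L i ` {..<k i}) = (\<Sum>i\<in>J. k i)" .
  moreover have "card (C ` {..c} :: 'i spider_vertex set) = Suc c" by (simp add: card_image inj_on_def)
  moreover have "card (prefix_set c J k) = card (C ` {..c} :: 'i spider_vertex set) + card (\<Union>i\<in>J. L i ` {..<k i})"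
    unfolding prefix_set_def by (rule card_Un_disjoint) (use assms in auto)
  ultimately show ?thesis by simp
qed

lemma downclosed_eq_lessThan:
  fixes A :: "nat set"
  assumes "finite A" and "\<And>j. Suc j \<in> A \<Longrightarrow> j \<in> A"
  shows "A = {..<card A}"
proof -
  have down: "i \<in> A" if "j \<in> A" "i \<le> j" for i j
    using that(2,1)
  proof (induction rule: inc_induct)
    case (step n)
    show ?case using assms(2)[OF step.IH[OF step.prems]] .
  qed
  have "\<exists>n. A = {..<n}"
  proof (cases "A = {}")
    case False
    have "A = {..Max A}"
    proof (intro equalityI subsetI)
      fix i assume "i \<in> A"
      then show "i \<in> {..Max A}" using assms(1) by simp
    next
      fix i assume "i \<in> {..Max A}"
      then show "i \<in> A" using down[OF Max_in[OF assms(1) False]] by blast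
    qed
    then have "A = {..<Suc (Max A)}" by (simp only: lessThan_Suc_atMost)
    then show ?thesis by blast
  qed auto
  then show ?thesis by auto
qed

text \<open>The legs a connected set can enter if it contains \<open>C 0\<close> and its last
  central vertex is \<open>C c\<close>: those at \<open>C 0\<close>, and those at \<open>C d\<close>
  only if \<open>C d\<close> is reached.\<close>

definition legs_below :: "'i set \<Rightarrow> nat \<Rightarrow> ('i \<Rightarrow> bool) \<Rightarrow> nat \<Rightarrow> 'i set" where
  "legs_below I d h c = {i \<in> I. c = d \<or> h i}"

context
  fixes I :: "'i set" and l :: "'i \<Rightarrow> nat" and d :: nat
  assumes fin: "finite I" and d: "d > 0"
begin

lemma spider_conn_iff:
  assumes "Z \<subseteq> spider_verts I l d" "C 0 \<in> Z"
  shows "Z \<in> conn_sets (spider_verts I l d) (spider_edges I l d h) \<longleftrightarrow>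
    (\<forall>x\<in>Z. x \<noteq> C 0 \<longrightarrow> spider_par d h x \<in> Z)"
  by (rule rooted_conn_sets_iff[OF spider_rooted[OF fin] assms])

text \<open>A set closed under parents meets each reachable leg in an initial segment, of length
  \<open>k i\<close>, and these lengths are free. For \<open>c = d\<close> the condition on
  \<open>C (Suc c)\<close> holds by itself.\<close>

lemma spider_rooted_conn_bij:
  assumes c: "c \<le> d"
  shows "bij_betw (prefix_set c (legs_below I d h c)) (PiE (legs_below I d h c) (\<lambda>i. {..l i}))
    {Z \<in> conn_sets (spider_verts I l d) (spider_edges I l d h). C 0 \<in> Z \<and> C c \<in> Z \<and> C (Suc c) \<notin> Z}"
    (is "bij_betw ?f ?P ?S")
proof -
  let ?J = "legs_below I d h c" and ?V = "spider_verts I l d"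
  let ?g = "\<lambda>Z. restrict (\<lambda>i. card {j. L i j \<in> Z}) ?J"
  have f: "?f k \<in> ?S" if k: "k \<in> ?P" for k
  proof -
    have kl: "k i \<le> l i" if "i \<in> ?J" for i using PiE_mem[OF k that] by simp
    have "?f k \<subseteq> ?V"
    proof
      fix z assume z: "z \<in> ?f k"
      show "z \<in> ?V"
      proof (cases z)
        case (L i j)
        then have "i \<in> ?J" "j < k i" using z by auto
        then show ?thesis using kl[of i] L by (simp add: legs_below_def)
      qed (use z c in simp)
    qed
    moreover have "spider_par d h x \<in> ?f k" if "x \<in> ?f k" "x \<noteq> C 0" for x
      using that c by (cases x) (auto simp: legs_below_def)
    ultimately show ?thesis using spider_conn_iff[of "?f k" h] by simp
  qed
  have Z: "?g Z \<in> ?P" "?f (?g Z) = Z" if Z: "Z \<in> ?S" for Z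
  proof -
    have sub: "Z \<subseteq> ?V" using Z by (simp add: conn_sets_def)
    have cl: "spider_par d h x \<in> Z" if "x \<in> Z" "x \<noteq> C 0" for x
      using Z spider_conn_iff[OF sub, of h] that by blast
    have central_down: "C i \<in> Z" if "C j \<in> Z" "i \<le> j" for i j
      using that(2,1)
    proof (induction rule: inc_induct)
      case (step n)
      then show ?case using cl[of "C (Suc n)"] by simp
    qed
    have central: "C j \<in> Z \<longleftrightarrow> j \<le> c" for j
    proof
      assume "C j \<in> Z"
      then show "j \<le> c" using Z central_down[of j "Suc c"] by (cases "j \<le> c") auto
    next
      assume "j \<le> c"
      then show "C j \<in> Z" using Z central_down[of c j] by simp
    qed
    have leg_sub: "{j. L i j \<in> Z} \<subseteq> {..<l i}" for i using sub by auto
    have leg: "{j. L i j \<in> Z} = {..<card {j. L i j \<in> Z}}" for i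
    proof (rule downclosed_eq_lessThan)
      show "finite {j. L i j \<in> Z}" by (rule finite_subset[OF leg_sub]) simp
      show "j \<in> {j. L i j \<in> Z}" if "Suc j \<in> {j. L i j \<in> Z}" for j
        using cl[of "L i (Suc j)"] that by simp
    qed
    have legJ: "i \<in> ?J" if "L i j \<in> Z" for i j
    proof -
      have "j < card {j. L i j \<in> Z}" using leg[of i] that by blast
      then have "0 \<in> {..<card {j. L i j \<in> Z}}" by simp
      then have "L i 0 \<in> Z" using leg[of i] by blast
      then have "C (if h i then 0 else d) \<in> Z" using cl[of "L i 0"] by simp
      moreover have "i \<in> I" using that sub by auto
      ultimately show ?thesis using central c by (auto simp: legs_below_def split: if_splits)
    qed
    have "card {j. L i j \<in> Z} \<le> l i" for i
      using card_mono[OF _ leg_sub[of i]] by simp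
    then show "?g Z \<in> ?P" by (simp add: PiE_iff)
    show "?f (?g Z) = Z"
    proof (rule set_eqI)
      fix z show "z \<in> ?f (?g Z) \<longleftrightarrow> z \<in> Z"
      proof (cases z)
        case (C j)
        then show ?thesis using central by simp
      next
        case (L i j)
        have "j < card {j. L i j \<in> Z} \<longleftrightarrow> L i j \<in> Z" using leg[of i] by blast
        then show ?thesis using L legJ by auto
      qed
    qed
  qed
  have gf: "?g (?f k) = k" if k: "k \<in> ?P" for k
  proof
    fix i
    have "{j. L i j \<in> ?f k} = {..<k i}" if "i \<in> ?J" using that by auto
    moreover have "k i = undefined" if "i \<notin> ?J" using PiE_arb[OF k that] .
    ultimately show "?g (?f k) i = k i" by (cases "i \<in> ?J") simp_all
  qed
  show ?thesis
    by (rule bij_betw_byWitness[where f' = ?g]) (intro ballI image_subsetI gf Z f; assumption)+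
qed

text \<open>One edge leaves along each reachable leg that is not contained completely, and one along
  the central path if it is not exhausted.\<close>

lemma spider_rooted_bd:
  assumes c: "c \<le> d" and k: "k \<in> PiE (legs_below I d h c) (\<lambda>i. {..l i})"
  shows "bd (spider_verts I l d) (spider_edges I l d h) (prefix_set c (legs_below I d h c) k) =
    (if c < d then 1 else 0) + (\<Sum>i\<in>legs_below I d h c. if k i < l i then 1 else 0)"
proof -
  let ?J = "legs_below I d h c" and ?V = "spider_verts I l d"
  let ?Z = "prefix_set c ?J k"
  have kl: "k i \<le> l i" if "i \<in> ?J" for i using PiE_mem[OF k that] by simp
  have J: "finite ?J" using fin by (simp add: legs_below_def)
  have "?Z \<in> conn_sets ?V (spider_edges I l d h)" "C 0 \<in> ?Z"
    using bij_betwE[OF spider_rooted_conn_bij[OF c]] k by auto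
  then have "bd ?V (spider_edges I l d h) ?Z = card {y \<in> ?V - ?Z. spider_par d h y \<in> ?Z}"
    by (intro rooted_bd[OF spider_rooted[OF fin]]) (auto simp: conn_sets_def)
  also have "{y \<in> ?V - ?Z. spider_par d h y \<in> ?Z} =
    (if c < d then {C (Suc c)} else {}) \<union> (\<lambda>i. L i (k i)) ` {i \<in> ?J. k i < l i}" (is "?A = ?B")
  proof (rule set_eqI)
    fix z show "z \<in> ?A \<longleftrightarrow> z \<in> ?B"
    proof (cases z)
      case (C j)
      then show ?thesis using c by auto
    next
      case (L i j)
      have "z \<in> ?A \<longleftrightarrow> i \<in> ?J \<and> j < l i \<and> j = k i"
      proof (cases "i \<in> ?J")
        case True
        then have "i \<in> I" "j = 0 \<longrightarrow> spider_par d h z \<in> ?Z" using L c by (auto simp: legs_below_def)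
        then show ?thesis using L True kl[OF True] by (cases j) auto
      next
        case False
        then show ?thesis using L c by (cases j) (auto simp: legs_below_def)
      qed
      then show ?thesis using L by auto
    qed
  qed
  also have "card ?B = (if c < d then 1 else 0) + card {i \<in> ?J. k i < l i}"
  proof -
    have "card ?B = card (if c < d then {C (Suc c)} else {} :: 'i spider_vertex set) +
        card ((\<lambda>i. L i (k i)) ` {i \<in> ?J. k i < l i})"
      by (rule card_Un_disjoint) (use J in auto)
    moreover have "card ((\<lambda>i. L i (k i)) ` {i \<in> ?J. k i < l i}) = card {i \<in> ?J. k i < l i}"
      by (intro card_image) (simp add: inj_on_def)
    ultimately show ?thesis by simp
  qed
  also have "card {i \<in> ?J. k i < l i} = (\<Sum>i\<in>?J. if k i < l i then 1 else 0)"
    using J by (simp add: sum.If_cases Int_def)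
  finally show ?thesis .
qed

lemma spider_rooted_sum:
  fixes G :: "nat \<Rightarrow> nat \<Rightarrow> complex" and h :: "'i \<Rightarrow> bool"
  assumes c: "c \<le> d"
  defines "V \<equiv> spider_verts I l d" and "E \<equiv> spider_edges I l d h" and "J \<equiv> legs_below I d h c"
  shows "(\<Sum>Z | Z \<in> conn_sets V E \<and> C 0 \<in> Z \<and> C c \<in> Z \<and> C (Suc c) \<notin> Z. G (card Z) (bd V E Z)) =
    (\<Sum>k\<in>PiE J (\<lambda>i. {..l i}). G (Suc c + (\<Sum>i\<in>J. k i))
       ((if c < d then 1 else 0) + (\<Sum>i\<in>J. if k i < l i then 1 else 0)))"
proof -
  have J: "finite J" using fin by (simp add: J_def legs_below_def)
  have "(\<Sum>Z | Z \<in> conn_sets V E \<and> C 0 \<in> Z \<and> C c \<in> Z \<and> C (Suc c) \<notin> Z. G (card Z) (bd V E Z)) =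
    (\<Sum>k\<in>PiE J (\<lambda>i. {..l i}). G (card (prefix_set c J k)) (bd V E (prefix_set c J k)))"
    unfolding V_def E_def J_def by (rule sum.reindex_bij_betw[OF spider_rooted_conn_bij[OF c], symmetric])
  also have "\<dots> = (\<Sum>k\<in>PiE J (\<lambda>i. {..l i}). G (Suc c + (\<Sum>i\<in>J. k i))
       ((if c < d then 1 else 0) + (\<Sum>i\<in>J. if k i < l i then 1 else 0)))"
  proof (rule sum.cong[OF refl])
    fix k assume k: "k \<in> PiE J (\<lambda>i. {..l i})"
    show "G (card (prefix_set c J k)) (bd V E (prefix_set c J k)) = G (Suc c + (\<Sum>i\<in>J. k i))
       ((if c < d then 1 else 0) + (\<Sum>i\<in>J. if k i < l i then 1 else 0))"
      using spider_rooted_bd[OF c k[unfolded J_def]] card_prefix_set[OF J, of c k]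
      unfolding J_def V_def E_def by (rule arg_cong2[where f = G, rotated])
  qed
  finally show ?thesis .
qed

text \<open>The case \<open>c = d\<close>: all legs are reachable, so the right-hand side does not
  mention \<open>h\<close>.\<close>

lemma spider_hubs_sum:
  fixes G :: "nat \<Rightarrow> nat \<Rightarrow> complex" and h :: "'i \<Rightarrow> bool"
  defines "V \<equiv> spider_verts I l d"
  shows "(\<Sum>Z | Z \<in> conn_sets V (spider_edges I l d h) \<and> C 0 \<in> Z \<and> C d \<in> Z. G (card Z) (bd V (spider_edges I l d h) Z)) =
    (\<Sum>k\<in>PiE I (\<lambda>i. {..l i}). G (Suc d + (\<Sum>i\<in>I. k i)) (\<Sum>i\<in>I. if k i < l i then 1 else 0))"
proof -
  have "{Z. Z \<in> conn_sets V (spider_edges I l d h) \<and> C 0 \<in> Z \<and> C d \<in> Z} =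
    {Z. Z \<in> conn_sets V (spider_edges I l d h) \<and> C 0 \<in> Z \<and> C d \<in> Z \<and> C (Suc d) \<notin> Z}"
    by (auto simp: conn_sets_def V_def)
  then show ?thesis using spider_rooted_sum[of d G h] by (simp add: V_def legs_below_def)
qed

text \<open>The sets are sorted by their last central vertex \<open>C c\<close>. As
  \<open>c < d\<close>, only legs at \<open>C 0\<close> are reachable, and the central path always
  supplies one outgoing edge.\<close>

lemma spider_root_only_sum:
  fixes G :: "nat \<Rightarrow> nat \<Rightarrow> complex" and h :: "'i \<Rightarrow> bool"
  defines "V \<equiv> spider_verts I l d" and "J \<equiv> {i \<in> I. h i}"
  shows "(\<Sum>Z | Z \<in> conn_sets V (spider_edges I l d h) \<and> C 0 \<in> Z \<and> C d \<notin> Z. G (card Z) (bd V (spider_edges I l d h) Z)) =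
    (\<Sum>c<d. \<Sum>k\<in>PiE J (\<lambda>i. {..l i}). G (Suc c + (\<Sum>i\<in>J. k i)) (1 + (\<Sum>i\<in>J. if k i < l i then 1 else 0)))"
proof -
  let ?E = "spider_edges I l d h"
  let ?S = "\<lambda>c. {Z \<in> conn_sets V ?E. C 0 \<in> Z \<and> C c \<in> Z \<and> C (Suc c) \<notin> Z}"
  have finV: "finite (conn_sets V ?E)"
    using fin by (simp add: V_def finite_conn_sets finite_spider_verts)
  have down: "C i \<in> Z" if "Z \<in> conn_sets V ?E" "C 0 \<in> Z" "C j \<in> Z" "i \<le> j" for Z i j
    using that(4,3)
  proof (induction rule: inc_induct)
    case (step n)
    moreover have "\<forall>x\<in>Z. x \<noteq> C 0 \<longrightarrow> spider_par d h x \<in> Z"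
      using that(1,2) spider_conn_iff[of Z h] by (simp add: conn_sets_def V_def)
    ultimately have "spider_par d h (C (Suc n)) \<in> Z" by blast
    then show ?case by simp
  qed
  have eq: "{Z. Z \<in> conn_sets V ?E \<and> C 0 \<in> Z \<and> C d \<notin> Z} = (\<Union>c\<in>{..<d}. ?S c)"
  proof (intro equalityI subsetI)
    fix Z assume Z: "Z \<in> {Z. Z \<in> conn_sets V ?E \<and> C 0 \<in> Z \<and> C d \<notin> Z}"
    define c where "c = (LEAST n. C (Suc n) \<notin> Z)"
    have ex: "C (Suc (d - 1)) \<notin> Z" using Z d by simp
    have c1: "C (Suc c) \<notin> Z" unfolding c_def using ex by (rule LeastI)
    have "c \<le> d - 1" unfolding c_def using ex by (rule Least_le)
    moreover have "C c \<in> Z"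
    proof (cases c)
      case 0
      then show ?thesis using Z by simp
    next
      case (Suc n)
      then show ?thesis using not_less_Least[of n "\<lambda>n. C (Suc n) \<notin> Z"] by (simp add: c_def)
    qed
    ultimately show "Z \<in> (\<Union>c\<in>{..<d}. ?S c)" using Z c1 d by (intro UN_I[of c]) auto
  next
    fix Z assume "Z \<in> (\<Union>c\<in>{..<d}. ?S c)"
    then obtain c where c: "c < d" "Z \<in> ?S c" by blast
    then show "Z \<in> {Z. Z \<in> conn_sets V ?E \<and> C 0 \<in> Z \<and> C d \<notin> Z}"
      using down[of Z d "Suc c"] by auto
  qed
  have disj: "?S a \<inter> ?S b = {}" if "a < b" for a b
  proof (rule equals0I)
    fix Z assume "Z \<in> ?S a \<inter> ?S b"
    then show False using down[of Z b "Suc a"] that by simp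
  qed
  have "(\<Sum>Z\<in>(\<Union>c\<in>{..<d}. ?S c). G (card Z) (bd V ?E Z)) = (\<Sum>c<d. \<Sum>Z\<in>?S c. G (card Z) (bd V ?E Z))"
  proof (rule sum.UNION_disjoint)
    show "\<forall>a\<in>{..<d}. \<forall>b\<in>{..<d}. a \<noteq> b \<longrightarrow> ?S a \<inter> ?S b = {}"
    proof (intro ballI impI)
      fix a b :: nat assume "a \<noteq> b"
      then consider "a < b" | "b < a" by linarith
      then show "?S a \<inter> ?S b = {}"
      proof cases
        case 2
        show ?thesis using disj[OF 2] by (simp only: Int_commute)
      qed (rule disj)
    qed
    show "\<forall>a\<in>{..<d}. finite (?S a)" using finV by simp
  qed simp
  also have "\<dots> = (\<Sum>c<d. \<Sum>k\<in>PiE J (\<lambda>i. {..l i}). G (Suc c + (\<Sum>i\<in>J. k i)) (1 + (\<Sum>i\<in>J. if k i < l i then 1 else 0)))"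
  proof (rule sum.cong[OF refl])
    fix c assume "c \<in> {..<d}"
    then have "legs_below I d h c = J" "c \<le> d" "c < d" by (auto simp: legs_below_def J_def)
    then show "(\<Sum>Z\<in>?S c. G (card Z) (bd V ?E Z)) =
      (\<Sum>k\<in>PiE J (\<lambda>i. {..l i}). G (Suc c + (\<Sum>i\<in>J. k i)) (1 + (\<Sum>i\<in>J. if k i < l i then 1 else 0)))"
      using spider_rooted_sum[of c G h] by (simp add: V_def)
  qed
  finally show ?thesis unfolding eq .
qed

end

section \<open>Sums over connected sets, split by the hubs they contain\<close>

definition spider_conn_sum :: "'i set \<Rightarrow> ('i \<Rightarrow> nat) \<Rightarrow> nat \<Rightarrow> ('i \<Rightarrow> bool) \<Rightarrow> (nat \<Rightarrow> nat \<Rightarrow> complex) \<Rightarrow>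
    ('i spider_vertex set \<Rightarrow> bool) \<Rightarrow> complex" where
  "spider_conn_sum I l d h G P = (\<Sum>Z | Z \<in> conn_sets (spider_verts I l d) (spider_edges I l d h) \<and> P Z.
     G (card Z) (bd (spider_verts I l d) (spider_edges I l d h) Z))"

lemma sum_split_pred:
  "finite A \<Longrightarrow> (\<Sum>x | x \<in> A \<and> Q x. f x) =
    (\<Sum>x | x \<in> A \<and> Q x \<and> P x. f x) + (\<Sum>x | x \<in> A \<and> Q x \<and> \<not> P x. f x)"
  by (subst sum.union_disjoint[symmetric]) (auto intro!: sum.cong)

lemma sum_indicator_eq_card:
  assumes "finite A"
  shows "(\<Sum>i\<in>A. if P i then 1 else 0) = card A \<longleftrightarrow> (\<forall>i\<in>A. P i)"
proof -
  have "(\<Sum>i\<in>A. if P i then 1 else 0) = card {i \<in> A. P i}"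
    using assms by (simp add: sum.If_cases Int_def)
  moreover have "card {i \<in> A. P i} = card A \<longleftrightarrow> {i \<in> A. P i} = A"
  proof
    assume "card {i \<in> A. P i} = card A"
    then show "{i \<in> A. P i} = A" using assms by (intro card_subset_eq) auto
  qed (rule arg_cong)
  ultimately show ?thesis by auto
qed

context
  fixes I :: "'i set" and l :: "'i \<Rightarrow> nat" and d :: nat
  assumes fin: "finite I" and d: "d > 0"
begin

lemma spider_conn_sum_split:
  "spider_conn_sum I l d h G (\<lambda>_. True) =
     spider_conn_sum I l d h G (\<lambda>Z. C 0 \<in> Z \<and> C d \<in> Z) +
     spider_conn_sum I l d h G (\<lambda>Z. C 0 \<in> Z \<and> C d \<notin> Z) +
     spider_conn_sum I l d h G (\<lambda>Z. C 0 \<notin> Z \<and> C d \<in> Z) +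
     spider_conn_sum I l d h G (\<lambda>Z. C 0 \<notin> Z \<and> C d \<notin> Z)"
proof -
  let ?A = "conn_sets (spider_verts I l d) (spider_edges I l d h)"
  have finA: "finite ?A" by (simp add: finite_conn_sets finite_spider_verts fin)
  show ?thesis
    unfolding spider_conn_sum_def
    by (subst sum_split_pred[OF finA, where Q = "\<lambda>_. True" and P = "\<lambda>Z. C 0 \<in> Z"],
        subst sum_split_pred[OF finA, where Q = "\<lambda>Z. True \<and> C 0 \<in> Z" and P = "\<lambda>Z. C d \<in> Z"],
        subst sum_split_pred[OF finA, where Q = "\<lambda>Z. True \<and> C 0 \<notin> Z" and P = "\<lambda>Z. C d \<in> Z"])
      (simp add: add.assoc)
qed

text \<open>Sets without the root are not closed under parents; the reversal turns those through
  \<open>C d\<close> alone into sets through the root.\<close>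

lemma spider_conn_sum_swap:
  "spider_conn_sum I l d h G (\<lambda>Z. C 0 \<notin> Z \<and> C d \<in> Z) =
   spider_conn_sum I l d (\<lambda>i. \<not> h i) G (\<lambda>Z. C 0 \<in> Z \<and> C d \<notin> Z)"
  unfolding spider_conn_sum_def
proof (rule graph_iso_sum[OF spider_swap_iso])
  show "edges_within (spider_verts I l d) (spider_edges I l d h)"
    using rooted_edge_subset[OF spider_rooted[OF fin]] by (simp add: edges_within_def)
  fix Z :: "'i spider_vertex set" assume Z: "Z \<subseteq> spider_verts I l d"
  have "C j \<in> spider_swap d ` Z \<longleftrightarrow> C (d - j) \<in> Z" if "j \<le> d" for j
  proof
    assume "C j \<in> spider_swap d ` Z"
    then obtain x where x: "x \<in> Z" "C j = spider_swap d x" by blast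
    then show "C (d - j) \<in> Z" using Z by (cases x) auto
  next
    assume "C (d - j) \<in> Z"
    then show "C j \<in> spider_swap d ` Z" using that by (intro image_eqI[of _ _ "C (d - j)"]) auto
  qed
  from this[of 0] this[of d] show "(C 0 \<in> spider_swap d ` Z \<and> C d \<notin> spider_swap d ` Z) = (C 0 \<notin> Z \<and> C d \<in> Z)"
    by auto
qed

text \<open>A set avoiding both ends of the central path cannot see which of them a leg is attached to.\<close>

lemma spider_edges_in_indep:
  assumes "W \<subseteq> spider_verts I l d" "C 0 \<in> W \<longleftrightarrow> C d \<in> W"
  shows "edges_in (spider_edges I l d h) W = edges_in (spider_edges I l d h') W"
proof -
  have "spider_par d h x \<in> W \<longleftrightarrow> spider_par d h' x \<in> W" for x
    using assms(2) by (cases x) auto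
  then show ?thesis by (simp only: rooted_edges_in[OF spider_rooted[OF fin] assms(1)])
qed

text \<open>Such a \<open>Z\<close> contains neither hub and its complement contains both, so
  \<open>spider_edges_in_indep\<close> covers the two edge counts involved.\<close>

lemma spider_conn_sum_rest:
  "spider_conn_sum I l d h G (\<lambda>Z. C 0 \<notin> Z \<and> C d \<notin> Z) =
   spider_conn_sum I l d h' G (\<lambda>Z. C 0 \<notin> Z \<and> C d \<notin> Z)"
  unfolding spider_conn_sum_def
proof (rule sum.cong)
  let ?V = "spider_verts I l d"
  have 1: "edges_in (spider_edges I l d h) Z = edges_in (spider_edges I l d h') Z"
    "edges_in (spider_edges I l d h) (?V - Z) = edges_in (spider_edges I l d h') (?V - Z)"
    if "Z \<subseteq> ?V" "C 0 \<notin> Z" "C d \<notin> Z" for Z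
    by (rule spider_edges_in_indep; use that in auto)+
  show "{Z. Z \<in> conn_sets ?V (spider_edges I l d h) \<and> C 0 \<notin> Z \<and> C d \<notin> Z} =
    {Z. Z \<in> conn_sets ?V (spider_edges I l d h') \<and> C 0 \<notin> Z \<and> C d \<notin> Z}"
  proof (rule Collect_cong)
    fix Z
    have "card Z = Suc (edges_in (spider_edges I l d h) Z) \<longleftrightarrow> card Z = Suc (edges_in (spider_edges I l d h') Z)"
      if "Z \<subseteq> ?V" "C 0 \<notin> Z" "C d \<notin> Z"
      by (simp only: 1(1)[OF that])
    then show "Z \<in> conn_sets ?V (spider_edges I l d h) \<and> C 0 \<notin> Z \<and> C d \<notin> Z \<longleftrightarrow>
        Z \<in> conn_sets ?V (spider_edges I l d h') \<and> C 0 \<notin> Z \<and> C d \<notin> Z"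
      unfolding conn_sets_def by blast
  qed
  fix Z assume "Z \<in> {Z. Z \<in> conn_sets ?V (spider_edges I l d h') \<and> C 0 \<notin> Z \<and> C d \<notin> Z}"
  then show "G (card Z) (bd ?V (spider_edges I l d h) Z) = G (card Z) (bd ?V (spider_edges I l d h') Z)"
    using 1(2)[of Z] by (simp add: conn_sets_def bd_def)
qed

lemma spider_conn_sum_hubs:
  "spider_conn_sum I l d h G (\<lambda>Z. C 0 \<in> Z \<and> C d \<in> Z) =
    (\<Sum>k\<in>PiE I (\<lambda>i. {..l i}). G (Suc d + (\<Sum>i\<in>I. k i)) (\<Sum>i\<in>I. if k i < l i then 1 else 0))"
  unfolding spider_conn_sum_def by (rule spider_hubs_sum[OF fin d])

lemma spider_conn_sum_one_hub:
  "spider_conn_sum I l d h G (\<lambda>Z. C 0 \<in> Z \<and> C d \<notin> Z) =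
    (\<Sum>c<d. \<Sum>k\<in>PiE {i \<in> I. h i} (\<lambda>i. {..l i}). G (Suc c + (\<Sum>i | i \<in> I \<and> h i. k i))
      (1 + (\<Sum>i | i \<in> I \<and> h i. if k i < l i then 1 else 0)))"
  unfolding spider_conn_sum_def by (rule spider_root_only_sum[OF fin d])

lemma spider_conn_sum_hubs_indep:
  "spider_conn_sum I l d h G (\<lambda>Z. C 0 \<in> Z \<and> C d \<in> Z) = spider_conn_sum I l d h' G (\<lambda>Z. C 0 \<in> Z \<and> C d \<in> Z)"
  unfolding spider_conn_sum_hubs ..

text \<open>Away from the hubs a vertex has at most one child, its successor on the same leg or
  path: a leg starts at a hub, and \<open>Z\<close> contains none. The bound keeps these sets out of
  \<open>spider_top_sum\<close>.\<close>

lemma spider_rest_bd_le: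
  assumes "Z \<in> conn_sets (spider_verts I l d) (spider_edges I l d h)" "C 0 \<notin> Z" "C d \<notin> Z"
  shows "bd (spider_verts I l d) (spider_edges I l d h) Z \<le> 2"
proof (rule rooted_bd_le_2[OF spider_rooted[OF fin] assms(1,2)])
  fix x y :: "'i spider_vertex"
  assume *: "x \<noteq> C 0" "y \<noteq> C 0" "spider_par d h x \<in> Z" "spider_par d h x = spider_par d h y"
  have step: "(\<exists>j. x = C (Suc j)) \<or> (\<exists>i j. x = L i (Suc j))"
    if "x \<noteq> C 0" "spider_par d h x \<in> Z" for x
  proof (cases x)
    case (C j)
    then show ?thesis using that(1) by (cases j) auto
  next
    case (L i j)
    then show ?thesis using that(2) assms(2,3) by (cases j) (auto split: if_splits)
  qed
  from step[OF *(1,3)] step[OF *(2)] *(3,4) show "x = y" by auto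
qed

text \<open>The weight \<open>2 (1 - z)\<close> of an outgoing edge makes a leg of length \<open>n\<close> contribute
  \<open>2 (1 - z) (1 + \<dots> + z^(n-1)) + z^n = 2 - z^n\<close>.\<close>

lemma spider_conn_sum_root_only:
  fixes z :: complex
  shows "spider_conn_sum I l d h (\<lambda>k j. z ^ k * (2 * (1 - z)) ^ j) (\<lambda>Z. C 0 \<in> Z \<and> C d \<notin> Z) =
     2 * z * (1 - z ^ d) * (\<Prod>i | i \<in> I \<and> h i. 2 - z ^ l i)"
proof -
  let ?J = "{i \<in> I. h i}" and ?y = "2 * (1 - z)"
  have J: "finite ?J" using fin by simp
  have leg: "(\<Sum>a\<le>n. z ^ a * ?y ^ (if a < n then 1 else 0)) = 2 - z ^ n" for n
  proof -
    have "(\<Sum>a\<le>n. z ^ a * ?y ^ (if a < n then 1 else 0)) = (\<Sum>a<n. z ^ a * ?y) + z ^ n"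
      by (simp add: lessThan_Suc_atMost[symmetric])
    also have "(\<Sum>a<n. z ^ a * ?y) = 2 * (1 - z ^ n)"
      by (simp add: one_diff_power_eq sum_distrib_right[symmetric] mult_ac)
    finally show ?thesis by simp
  qed
  have "(\<Sum>k\<in>PiE ?J (\<lambda>i. {..l i}). z ^ (Suc c + (\<Sum>i\<in>?J. k i)) * ?y ^ (1 + (\<Sum>i\<in>?J. if k i < l i then 1 else 0))) =
      ?y * z * z ^ c * (\<Prod>i\<in>?J. 2 - z ^ l i)" for c
  proof -
    have "(\<Sum>k\<in>PiE ?J (\<lambda>i. {..l i}). z ^ (Suc c + (\<Sum>i\<in>?J. k i)) * ?y ^ (1 + (\<Sum>i\<in>?J. if k i < l i then 1 else 0))) =
      (\<Sum>k\<in>PiE ?J (\<lambda>i. {..l i}). ?y * z * z ^ c * (\<Prod>i\<in>?J. z ^ k i * ?y ^ (if k i < l i then 1 else 0)))"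
      by (intro sum.cong refl) (simp only: power_add power_sum prod.distrib power_one_right power_Suc mult_ac)
    also have "\<dots> = ?y * z * z ^ c * (\<Prod>i\<in>?J. \<Sum>a\<le>l i. z ^ a * ?y ^ (if a < l i then 1 else 0))"
      by (subst prod_sum_PiE[OF J]) (simp_all add: sum_distrib_left)
    also have "\<dots> = ?y * z * z ^ c * (\<Prod>i\<in>?J. 2 - z ^ l i)" by (simp only: leg)
    finally show ?thesis .
  qed
  then have "spider_conn_sum I l d h (\<lambda>k j. z ^ k * ?y ^ j) (\<lambda>Z. C 0 \<in> Z \<and> C d \<notin> Z) =
      (\<Sum>c<d. ?y * z * z ^ c * (\<Prod>i\<in>?J. 2 - z ^ l i))"
    unfolding spider_conn_sum_one_hub by (simp only:)
  \<comment> \<open>The factor \<open>1 - z\<close> of the central outgoing edge makes the geometric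
    sum over \<open>c\<close> telescope to \<open>1 - z ^ d\<close>.\<close>
  also have "\<dots> = 2 * z * ((1 - z) * (\<Sum>c<d. z ^ c)) * (\<Prod>i\<in>?J. 2 - z ^ l i)"
    by (simp only: sum_distrib_left sum_distrib_right mult_ac)
  also have "(1 - z) * (\<Sum>c<d. z ^ c) = 1 - z ^ d" by (simp add: one_diff_power_eq)
  finally show ?thesis .
qed

lemma spider_mid_difference:
  fixes z :: complex
  defines "A \<equiv> \<lambda>h. \<Prod>i | i \<in> I \<and> h i. 2 - z ^ l i" and "G \<equiv> \<lambda>k j. z ^ k * (2 * (1 - z)) ^ j"
  assumes "spider_conn_sum I l d h G (\<lambda>_. True) = spider_conn_sum I l d h' G (\<lambda>_. True)"
  shows "2 * z * (1 - z ^ d) * (A h + A (\<lambda>i. \<not> h i)) = 2 * z * (1 - z ^ d) * (A h' + A (\<lambda>i. \<not> h' i))"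
proof -
  have "spider_conn_sum I l d g G (\<lambda>_. True) =
     spider_conn_sum I l d h G (\<lambda>Z. C 0 \<in> Z \<and> C d \<in> Z) +
     2 * z * (1 - z ^ d) * (A g + A (\<lambda>i. \<not> g i)) +
     spider_conn_sum I l d h G (\<lambda>Z. C 0 \<notin> Z \<and> C d \<notin> Z)" for g
    unfolding spider_conn_sum_split[of g] spider_conn_sum_swap[of g]
      spider_conn_sum_hubs_indep[of g _ h] spider_conn_sum_rest[of g _ h]
    unfolding G_def A_def spider_conn_sum_root_only by (simp add: distrib_left)
  then show ?thesis using assms(3) by simp
qed

text \<open>The weight keeps the sets with exactly \<open>card I\<close> outgoing edges. A set with
  one hub has at most one more than the legs there, too few because the other hub has at least two
  legs; a set with no hub has at most 2, while \<open>card I \<ge> 4\<close>. With both hubs,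
  equality means that no leg is contained completely.\<close>

lemma spider_top_sum:
  fixes z :: complex
  assumes "card {i \<in> I. h i} \<ge> 2" "card {i \<in> I. \<not> h i} \<ge> 2"
  shows "spider_conn_sum I l d h (\<lambda>k j. if j = card I then z ^ k else 0) (\<lambda>_. True) =
    z ^ Suc d * (\<Prod>i\<in>I. \<Sum>a<l i. z ^ a)"
proof -
  let ?G = "\<lambda>k j. if j = card I then z ^ k else 0"
  have cardI: "card I = card {i \<in> I. g i} + card {i \<in> I. \<not> g i}" for g
    using fin by (subst card_Un_disjoint[symmetric]) (auto intro!: arg_cong[of _ _ card])
  have one: "spider_conn_sum I l d g ?G (\<lambda>Z. C 0 \<in> Z \<and> C d \<notin> Z) = 0" if "card {i \<in> I. \<not> g i} \<ge> 2" for g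
    unfolding spider_conn_sum_one_hub
  proof (intro sum.neutral ballI)
    fix c k
    have "(\<Sum>i | i \<in> I \<and> g i. if k i < l i then 1 else 0) \<le> (\<Sum>i | i \<in> I \<and> g i. 1 :: nat)"
      by (intro sum_mono) auto
    then have "1 + (\<Sum>i | i \<in> I \<and> g i. if k i < l i then 1 else 0) < card I"
      using that cardI[of g] by simp
    then show "?G (Suc c + (\<Sum>i | i \<in> I \<and> g i. k i)) (1 + (\<Sum>i | i \<in> I \<and> g i. if k i < l i then 1 else 0)) = 0"
      by (metis less_irrefl)
  qed
  have rest: "spider_conn_sum I l d h ?G (\<lambda>Z. C 0 \<notin> Z \<and> C d \<notin> Z) = 0"
    unfolding spider_conn_sum_def
  proof (intro sum.neutral ballI)
    fix Z assume "Z \<in> {Z. Z \<in> conn_sets (spider_verts I l d) (spider_edges I l d h) \<and> C 0 \<notin> Z \<and> C d \<notin> Z}"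
    then have "bd (spider_verts I l d) (spider_edges I l d h) Z \<le> 2" using spider_rest_bd_le by blast
    then show "?G (card Z) (bd (spider_verts I l d) (spider_edges I l d h) Z) = 0"
      using assms cardI[of h] by auto
  qed
  have "spider_conn_sum I l d h ?G (\<lambda>_. True) =
    (\<Sum>k\<in>PiE I (\<lambda>i. {..l i}). ?G (Suc d + (\<Sum>i\<in>I. k i)) (\<Sum>i\<in>I. if k i < l i then 1 else 0))"
    unfolding spider_conn_sum_split[of h] spider_conn_sum_swap[of h] rest one[OF assms(2)]
      using one[of "\<lambda>i. \<not> h i"] assms(1) by (simp add: spider_conn_sum_hubs)
  also have "\<dots> = (\<Sum>k\<in>PiE I (\<lambda>i. {..l i}). z ^ Suc d * (\<Prod>i\<in>I. if k i < l i then z ^ k i else 0))"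
  proof (rule sum.cong[OF refl])
    fix k
    show "?G (Suc d + (\<Sum>i\<in>I. k i)) (\<Sum>i\<in>I. if k i < l i then 1 else 0) =
      z ^ Suc d * (\<Prod>i\<in>I. if k i < l i then z ^ k i else 0)"
    proof (cases "\<forall>i\<in>I. k i < l i")
      case True
      then have "(\<Prod>i\<in>I. if k i < l i then z ^ k i else 0) = z ^ (\<Sum>i\<in>I. k i)"
        by (simp add: power_sum)
      then show ?thesis using True by (simp add: power_add)
    next
      case False
      then have "(\<Prod>i\<in>I. if k i < l i then z ^ k i else 0) = 0" using fin by auto
      moreover have "(\<Sum>i\<in>I. if k i < l i then 1 else 0) \<noteq> card I"
        using False sum_indicator_eq_card[OF fin, of "\<lambda>i. k i < l i"] by blast
      ultimately show ?thesis by (simp only: if_False mult_zero_right)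
    qed
  qed
  also have "\<dots> = z ^ Suc d * (\<Prod>i\<in>I. \<Sum>a\<le>l i. if a < l i then z ^ a else 0)"
    by (subst prod_sum_PiE[OF fin]) (simp_all add: sum_distrib_left)
  also have "\<dots> = z ^ Suc d * (\<Prod>i\<in>I. \<Sum>a<l i. z ^ a)"
    by (simp add: lessThan_Suc_atMost[symmetric])
  finally show ?thesis .
qed

text \<open>The degree of a hub: its legs, each with a first vertex as \<open>l i > 0\<close>, and
  one edge of the central path. The reversal carries the count from \<open>C 0\<close> to
  \<open>C d\<close>.\<close>

lemma spider_hub_bd:
  assumes "\<And>i. i \<in> I \<Longrightarrow> l i > 0"
  shows "bd (spider_verts I l d) (spider_edges I l d h) {C 0} = Suc (card {i \<in> I. h i})"
    "bd (spider_verts I l d) (spider_edges I l d h) {C d} = Suc (card {i \<in> I. \<not> h i})"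
proof -
  let ?V = "spider_verts I l d"
  have root: "bd ?V (spider_edges I l d g) {C 0} = Suc (card {i \<in> I. g i})" for g
  proof -
    have "{y \<in> ?V - {C 0}. spider_par d g y \<in> {C 0}} = insert (C 1) ((\<lambda>i. L i 0) ` {i \<in> I. g i})" (is "?A = ?B")
    proof (rule set_eqI)
      fix z show "z \<in> ?A \<longleftrightarrow> z \<in> ?B"
        using d assms by (cases z) auto
    qed
    moreover have "card ?B = Suc (card {i \<in> I. g i})"
      using fin by (subst card_insert_disjoint) (auto simp: card_image inj_on_def)
    ultimately show ?thesis by (subst rooted_bd[OF spider_rooted[OF fin]]) auto
  qed
  then show "bd ?V (spider_edges I l d h) {C 0} = Suc (card {i \<in> I. h i})" .
  have "edges_within ?V (spider_edges I l d h)"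
    using rooted_edge_subset[OF spider_rooted[OF fin]] by (simp add: edges_within_def)
  from graph_iso_conn_sets(2)[OF spider_swap_iso this, of "{C d}"]
  show "bd ?V (spider_edges I l d h) {C d} = Suc (card {i \<in> I. \<not> h i})"
    using root[of "\<lambda>i. \<not> h i"] by simp
qed

end

section \<open>Recovering the spider\<close>

text \<open>Let \<open>m\<close> be the largest entry of \<open>A\<close> and \<open>B\<close>. At
  the root special to \<open>q m\<close>, each product vanishes iff it contains the factor
  \<open>q m\<close>; so both do, and the factor can be cancelled.\<close>

lemma poly_mset_prod_unique:
  fixes q :: "nat \<Rightarrow> complex poly"
  assumes root: "\<And>m. m > 0 \<Longrightarrow> \<exists>\<zeta>. poly (q m) \<zeta> = 0 \<and> (\<forall>k. 0 < k \<longrightarrow> k < m \<longrightarrow> poly (q k) \<zeta> \<noteq> 0)"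
    and nz: "\<And>m. m > 0 \<Longrightarrow> q m \<noteq> 0"
    and "0 \<notin># A" "0 \<notin># B" "(\<Prod>x\<in>#A. q x) = (\<Prod>x\<in>#B. q x)"
  shows "A = B"
  using assms(3-5)
proof (induction "size A" arbitrary: A B rule: less_induct)
  case less
  show ?case
  proof (cases "A + B = {#}")
    case False
    define m where "m = Max (set_mset (A + B))"
    have m: "m \<in># A + B" "\<And>x. x \<in># A + B \<Longrightarrow> x \<le> m"
      using False unfolding m_def by (auto intro!: Max_in Max_ge simp del: set_mset_union)
    then have "m > 0" using less.prems by (metis gr0I union_iff)
    then obtain \<zeta> where \<zeta>: "poly (q m) \<zeta> = 0" "\<And>k. 0 < k \<Longrightarrow> k < m \<Longrightarrow> poly (q k) \<zeta> \<noteq> 0"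
      using root by blast
    have zero: "poly (\<Prod>x\<in>#X. q x) \<zeta> = 0 \<longleftrightarrow> m \<in># X" if X: "0 \<notin># X" "X \<subseteq># A + B" for X
    proof -
      have "poly (q x) \<zeta> = 0 \<longleftrightarrow> x = m" if "x \<in># X" for x
      proof -
        have "x \<le> m" "x > 0" using m(2)[OF mset_subset_eqD[OF X(2) that]] X(1) that by (auto intro: gr0I)
        then show ?thesis using \<zeta> by (cases "x = m") auto
      qed
      then show ?thesis by (auto simp: poly_prod_mset prod_mset_zero_iff image_iff)
    qed
    have "m \<in># A \<longleftrightarrow> m \<in># B" using zero[of A] zero[of B] less.prems by simp
    then have mAB: "m \<in># A" "m \<in># B" using m(1) by auto
    then obtain A' B' where AB: "A = add_mset m A'" "B = add_mset m B'" by (meson mset_add)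
    then have "q m * (\<Prod>x\<in>#A'. q x) = q m * (\<Prod>x\<in>#B'. q x)" using less.prems by simp
    then have "(\<Prod>x\<in>#A'. q x) = (\<Prod>x\<in>#B'. q x)" using nz[OF \<open>m > 0\<close>] by simp
    then have "A' = B'" using less.hyps[of A' B'] less.prems AB by auto
    then show ?thesis using AB by simp
  qed simp
qed

text \<open>The special root is a primitive \<open>m\<close>-th root of unity.\<close>

lemma one_minus_monom_unique:
  assumes "0 \<notin># A" "0 \<notin># B" "(\<Prod>x\<in>#A. 1 - monom (1::complex) x) = (\<Prod>x\<in>#B. 1 - monom 1 x)"
  shows "A = B"
proof (rule poly_mset_prod_unique[OF _ _ assms])
  fix m :: nat assume m: "m > 0"
  let ?f = "\<lambda>k. cis (2 * pi * real k / real m)"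
  have inj: "inj_on ?f {..<m}" using bij_betw_roots_unity[OF m] by (simp add: bij_betw_def)
  have pow: "?f 1 ^ k = ?f k" for k by (simp add: Complex.DeMoivre mult_ac)
  have "?f 1 ^ m = 1" unfolding pow using m by simp
  moreover have "?f 1 ^ k \<noteq> 1" if "0 < k" "k < m" for k
  proof
    assume "?f 1 ^ k = 1"
    then have "?f k = ?f 0" unfolding pow by simp
    then show False using inj_onD[OF inj, of k 0] that m by simp
  qed
  ultimately show "\<exists>\<zeta>. poly (1 - monom 1 m) \<zeta> = (0::complex) \<and>
      (\<forall>k. 0 < k \<longrightarrow> k < m \<longrightarrow> poly (1 - monom 1 k) \<zeta> \<noteq> 0)"
    by (intro exI[of _ "?f 1"]) (auto simp: poly_monom)
  have "poly (1 - monom (1::complex) m) 0 \<noteq> 0" using m by (simp add: poly_monom power_0_left)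
  then show "1 - monom (1::complex) m \<noteq> 0" by force
qed

text \<open>The special root is the positive real \<open>m\<close>-th root of 2: it exceeds 1, so
  its smaller powers stay below 2.\<close>

lemma two_minus_monom_unique:
  assumes "0 \<notin># A" "0 \<notin># B" "(\<Prod>x\<in>#A. [:2:] - monom (1::complex) x) = (\<Prod>x\<in>#B. [:2:] - monom 1 x)"
  shows "A = B"
proof (rule poly_mset_prod_unique[OF _ _ assms])
  fix m :: nat assume m: "m > 0"
  define r where "r = root m 2"
  have r: "r ^ m = 2" "r > 1" using m by (simp_all add: r_def)
  have "complex_of_real r ^ m = 2" using r(1) by (metis of_real_numeral of_real_power)
  moreover have "complex_of_real r ^ k \<noteq> 2" if "k < m" for k
  proof
    assume "complex_of_real r ^ k = 2"
    then have "r ^ k = 2" by (metis of_real_eq_iff of_real_numeral of_real_power)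
    then show False using power_strict_increasing[OF that r(2)] r(1) by simp
  qed
  ultimately show "\<exists>\<zeta>. poly ([:2:] - monom 1 m) \<zeta> = (0::complex) \<and>
      (\<forall>k. 0 < k \<longrightarrow> k < m \<longrightarrow> poly ([:2:] - monom 1 k) \<zeta> \<noteq> 0)"
    by (intro exI[of _ "complex_of_real r"]) (auto simp: poly_monom)
  have "poly ([:2:] - monom (1::complex) m) 0 \<noteq> 0" using m by (simp add: poly_monom power_0_left)
  then show "[:2:] - monom (1::complex) m \<noteq> 0" by force
qed

lemma exists_bij_of_image_mset_eq:
  assumes "finite A" "finite B" "image_mset f (mset_set A) = image_mset g (mset_set B)"
  shows "\<exists>\<sigma>. bij_betw \<sigma> A B \<and> (\<forall>x\<in>A. g (\<sigma> x) = f x)"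
  using assms
proof (induction A arbitrary: B rule: finite_induct)
  case empty
  then have "B = {}" by (simp add: mset_set_empty_iff)
  then show ?case by (simp add: bij_betw_def)
next
  case (insert a A)
  have "f a \<in># image_mset g (mset_set B)" using insert.prems(2) insert.hyps by (simp flip: insert.prems(2))
  then obtain b where b: "b \<in> B" "g b = f a" using insert.prems(1) by auto
  have "mset_set B = add_mset b (mset_set (B - {b}))"
    using b(1) insert.prems(1) by (metis mset_set.remove)
  then have "image_mset f (mset_set A) = image_mset g (mset_set (B - {b}))"
    using insert.prems(2) insert.hyps b(2) by simp
  then obtain \<sigma> where \<sigma>: "bij_betw \<sigma> A (B - {b})" "\<forall>x\<in>A. g (\<sigma> x) = f x"
    using insert.IH[of "B - {b}"] insert.prems(1) by auto
  have "bij_betw (\<sigma>(a := b)) A (B - {b})"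
    using \<sigma>(1) insert.hyps(2) by (subst bij_betw_cong[of _ _ \<sigma>]) auto
  then have "bij_betw (\<sigma>(a := b)) (insert a A) (insert b (B - {b}))"
    using notIn_Un_bij_betw[of a A "\<sigma>(a := b)" "B - {b}"] insert.hyps(2) by simp
  then have "bij_betw (\<sigma>(a := b)) (insert a A) B" using b(1) by (simp add: insert_absorb)
  moreover have "g ((\<sigma>(a := b)) x) = f x" if "x \<in> insert a A" for x
    using that \<sigma>(2) b(2) by auto
  ultimately show ?case by blast
qed

lemma mset_set_split:
  "finite I \<Longrightarrow> mset_set I = mset_set {i \<in> I. h i} + mset_set {i \<in> I. \<not> h i}"
  by (subst mset_set_Union[symmetric]) (auto intro!: arg_cong[of _ _ mset_set])

text \<open>The complementary parts have equal length multisets too, because the total over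
  \<open>I\<close> is the same; bijections of the two parts are glued.\<close>

lemma exists_bij_preserving_part:
  assumes I: "finite I"
    and eq: "image_mset l (mset_set {i \<in> I. h i}) = image_mset l (mset_set {i \<in> I. g i})"
  shows "\<exists>\<tau>. bij_betw \<tau> I I \<and> (\<forall>i\<in>I. l (\<tau> i) = l i \<and> g (\<tau> i) = h i)"
proof -
  let ?A = "{i \<in> I. h i}" and ?B = "{i \<in> I. g i}" and ?A' = "{i \<in> I. \<not> h i}" and ?B' = "{i \<in> I. \<not> g i}"
  have "image_mset l (mset_set ?A) + image_mset l (mset_set ?A') =
      image_mset l (mset_set ?B) + image_mset l (mset_set ?B')"
    using mset_set_split[OF I, of h] mset_set_split[OF I, of g] by (metis image_mset_union)
  then have eq': "image_mset l (mset_set ?A') = image_mset l (mset_set ?B')" using eq by simp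
  obtain s where s: "bij_betw s ?A ?B" "\<forall>x\<in>?A. l (s x) = l x"
    using exists_bij_of_image_mset_eq[OF _ _ eq] I by auto
  obtain t where t: "bij_betw t ?A' ?B'" "\<forall>x\<in>?A'. l (t x) = l x"
    using exists_bij_of_image_mset_eq[OF _ _ eq'] I by auto
  define \<tau> where "\<tau> i = (if h i then s i else t i)" for i
  have "bij_betw \<tau> ?A ?B" using s(1) by (subst bij_betw_cong[of _ _ s]) (auto simp: \<tau>_def)
  moreover have "bij_betw \<tau> ?A' ?B'" using t(1) by (subst bij_betw_cong[of _ _ t]) (auto simp: \<tau>_def)
  ultimately have "bij_betw \<tau> (?A \<union> ?A') (?B \<union> ?B')" by (rule bij_betw_combine) auto
  moreover have "?A \<union> ?A' = I" "?B \<union> ?B' = I" by auto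
  ultimately have "bij_betw \<tau> I I" by simp
  moreover have "l (\<tau> i) = l i \<and> g (\<tau> i) = h i" if "i \<in> I" for i
  proof (cases "h i")
    case True
    then show ?thesis using that s(2) bij_betwE[OF s(1)] by (auto simp: \<tau>_def)
  next
    case False
    then show ?thesis using that t(2) bij_betwE[OF t(1)] by (auto simp: \<tau>_def)
  qed
  ultimately show ?thesis by blast
qed

text \<open>\<open>A h\<close> and \<open>A (\<lambda>i. \<not> h i)\<close> have the same sum as
  the pair for \<open>g\<close>, and the same product, namely the one over all legs. Hence
  \<open>(A h - A g) * (A h - A (\<lambda>i. \<not> g i)) = 0\<close>, and polynomials have no zero
  divisors.\<close>

lemma spider_legs_determined:
  assumes I: "finite I" and d: "d > 0" and l: "\<And>i. i \<in> I \<Longrightarrow> l i > 0"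
    and eq: "\<And>G. spider_conn_sum I l d h G (\<lambda>_. True) = spider_conn_sum I l d g G (\<lambda>_. True)"
  shows "image_mset l (mset_set {i \<in> I. h i}) = image_mset l (mset_set {i \<in> I. g i}) \<or>
    image_mset l (mset_set {i \<in> I. h i}) = image_mset l (mset_set {i \<in> I. \<not> g i})"
proof -
  define A where "A f = (\<Prod>i | i \<in> I \<and> f i. [:2:] - monom (1::complex) (l i))" for f
  have poly_A: "poly (A f) z = (\<Prod>i | i \<in> I \<and> f i. 2 - z ^ l i)" for f z
    by (simp add: A_def poly_prod poly_monom)
  let ?c = "[:2:] * [:0, 1:] * (1 - monom (1::complex) d)"
  have "poly (?c * (A h + A (\<lambda>i. \<not> h i))) = poly (?c * (A g + A (\<lambda>i. \<not> g i)))"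
  proof
    fix z
    show "poly (?c * (A h + A (\<lambda>i. \<not> h i))) z = poly (?c * (A g + A (\<lambda>i. \<not> g i))) z"
      using spider_mid_difference[OF I d eq, of z] by (simp add: poly_A poly_monom)
  qed
  then have "?c * (A h + A (\<lambda>i. \<not> h i)) = ?c * (A g + A (\<lambda>i. \<not> g i))"
    by (simp only: poly_eq_poly_eq_iff)
  moreover have "?c \<noteq> 0"
  proof -
    have "poly (1 - monom (1::complex) d) 0 \<noteq> 0" using d by (simp add: poly_monom power_0_left)
    then have "1 - monom (1::complex) d \<noteq> 0" by force
    then show ?thesis by simp
  qed
  ultimately have sum: "A h + A (\<lambda>i. \<not> h i) = A g + A (\<lambda>i. \<not> g i)"
    by (metis mult_cancel_left)
  have AA: "A f * A (\<lambda>i. \<not> f i) = (\<Prod>i\<in>I. [:2:] - monom (1::complex) (l i))" for f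
    unfolding A_def using I
    by (subst prod.union_disjoint[symmetric]) (auto intro!: prod.cong)
  have "(A h - A g) * (A h - A (\<lambda>i. \<not> g i)) = A h * A h - A h * (A g + A (\<lambda>i. \<not> g i)) + A g * A (\<lambda>i. \<not> g i)"
    by (simp add: algebra_simps)
  also have "\<dots> = A g * A (\<lambda>i. \<not> g i) - A h * A (\<lambda>i. \<not> h i)"
    unfolding sum[symmetric] by (simp add: algebra_simps)
  also have "\<dots> = 0" by (simp add: AA)
  finally have "A h = A g \<or> A h = A (\<lambda>i. \<not> g i)" by simp
  moreover have "image_mset l (mset_set {i \<in> I. h i}) = image_mset l (mset_set {i \<in> I. f i})"
    if "A h = A f" for f
  proof (rule two_minus_monom_unique)
    show "0 \<notin># image_mset l (mset_set {i \<in> I. h i})" "0 \<notin># image_mset l (mset_set {i \<in> I. f i})"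
      using l I by (auto simp: image_iff)
    show "(\<Prod>x\<in>#image_mset l (mset_set {i \<in> I. h i}). [:2:] - monom (1::complex) x) =
        (\<Prod>x\<in>#image_mset l (mset_set {i \<in> I. f i}). [:2:] - monom 1 x)"
      using that by (simp add: A_def prod_unfold_prod_mset image_mset.compositionality o_def)
  qed
  ultimately show ?thesis by blast
qed

text \<open>Multiplied by \<open>(1 - z) ^ card I\<close>, the top sum becomes
  \<open>z ^ Suc d\<close> times the product of the \<open>1 - z ^ l i\<close>. These factors have
  constant term 1, so the order at 0 gives \<open>d\<close>.\<close>

lemma spider_lengths_determined:
  fixes I :: "'i set" and I' :: "'j set"
  assumes I: "finite I" "finite I'" and d: "d > 0" "d' > 0"
    and l: "\<And>i. i \<in> I \<Longrightarrow> l i > 0" "\<And>i. i \<in> I' \<Longrightarrow> l' i > 0"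
    and h: "card {i \<in> I. h i} \<ge> 2" "card {i \<in> I. \<not> h i} \<ge> 2"
      "card {i \<in> I'. h' i} \<ge> 2" "card {i \<in> I'. \<not> h' i} \<ge> 2"
    and card: "card I = card I'"
    and eq: "\<And>G. spider_conn_sum I l d h G (\<lambda>_. True) = spider_conn_sum I' l' d' h' G (\<lambda>_. True)"
  shows "d = d'" "image_mset l (mset_set I) = image_mset l' (mset_set I')"
proof -
  let ?p = "\<lambda>x. 1 - monom (1::complex) x"
  have "poly (monom 1 (Suc d) * (\<Prod>i\<in>I. ?p (l i))) = poly (monom 1 (Suc d') * (\<Prod>i\<in>I'. ?p (l' i)))"
  proof
    fix z :: complex
    have "z ^ Suc d * (\<Prod>i\<in>I. \<Sum>a<l i. z ^ a) = z ^ Suc d' * (\<Prod>i\<in>I'. \<Sum>a<l' i. z ^ a)"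
      using eq[of "\<lambda>k j. if j = card I then z ^ k else 0"]
        spider_top_sum[OF I(1) d(1) h(1,2)] spider_top_sum[OF I(2) d(2) h(3,4)] card by simp
    then show "poly (monom 1 (Suc d) * (\<Prod>i\<in>I. ?p (l i))) z = poly (monom 1 (Suc d') * (\<Prod>i\<in>I'. ?p (l' i))) z"
      using card by (auto simp: poly_monom poly_prod one_diff_power_eq prod.distrib mult.left_commute)
  qed
  then have P: "monom 1 (Suc d) * (\<Prod>i\<in>I. ?p (l i)) = monom 1 (Suc d') * (\<Prod>i\<in>I'. ?p (l' i))"
    by (simp only: poly_eq_poly_eq_iff)
  have "poly (\<Prod>i\<in>I. ?p (l i)) 0 = 1" "poly (\<Prod>i\<in>I'. ?p (l' i)) 0 = 1"
    unfolding poly_prod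
    by (intro prod.neutral ballI, simp add: poly_monom power_0_left l[THEN gr_implies_not0])+
  then have "order 0 (monom 1 (Suc d) * (\<Prod>i\<in>I. ?p (l i))) = Suc d"
    "order 0 (monom 1 (Suc d') * (\<Prod>i\<in>I'. ?p (l' i))) = Suc d'"
    by (subst order_mult; force simp: order_0I)+
  then show "d = d'" using P by simp
  then have "(\<Prod>i\<in>I. ?p (l i)) = (\<Prod>i\<in>I'. ?p (l' i))" using P by simp
  then show "image_mset l (mset_set I) = image_mset l' (mset_set I')"
    using l I by (intro one_minus_monom_unique)
      (auto simp: image_iff prod_unfold_prod_mset image_mset.compositionality o_def)
qed

section \<open>Finding the hubs and passing to spiders\<close>

lemma rooted_singletons:
  fixes g :: "nat \<Rightarrow> nat"
  assumes rt: "rooted V E r par ht"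
  shows "(\<Sum>Z\<in>conn_sets V E. if card Z = 1 then g (bd V E Z) else 0) = (\<Sum>x\<in>V. g (bd V E {x}))"
proof -
  have fin: "finite (conn_sets V E)" using rootedD(1)[OF rt] by (rule finite_conn_sets)
  have "{x} \<in> conn_sets V E" if "x \<in> V" for x
  proof -
    have "{y \<in> {x}. y \<noteq> r \<and> par y \<in> {x}} = {}"
      using rootedD(5)[OF rt, of x] that by auto
    then show ?thesis using that rooted_edges_in[OF rt, of "{x}"] by (simp add: conn_sets_def)
  qed
  then have "(\<lambda>x. {x}) ` V = {Z \<in> conn_sets V E. card Z = 1}"
    by (auto simp: conn_sets_def card_1_singleton_iff)
  moreover have "(\<Sum>Z\<in>conn_sets V E. if card Z = 1 then g (bd V E Z) else 0) =
      (\<Sum>Z | Z \<in> conn_sets V E \<and> card Z = 1. g (bd V E Z))"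
    using fin by (simp add: sum.inter_filter)
  ultimately have "(\<Sum>Z\<in>conn_sets V E. if card Z = 1 then g (bd V E Z) else 0) =
      (\<Sum>Z\<in>(\<lambda>x. {x}) ` V. g (bd V E Z))" by simp
  then show ?thesis by (simp add: sum.reindex)
qed

text \<open>With two children \<open>x\<close> and \<open>y\<close> of \<open>p\<close>, none of the
  four vertices \<open>p\<close>, \<open>r\<close>, \<open>x\<close>, \<open>y\<close> has an edge
  to a parent inside \<open>V - {p}\<close>. So at most \<open>card V - 4\<close> edges avoid
  \<open>p\<close>, and \<open>bd V E {p} \<ge> 3\<close>.\<close>

lemma rooted_unique_child:
  assumes rt: "rooted V E r par ht" and p: "p \<in> V" "p \<noteq> r" "bd V E {p} \<le> 2"
    and x: "x \<in> V" "x \<noteq> r" "par x = p" and y: "y \<in> V" "y \<noteq> r" "par y = p"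
  shows "x = y"
proof (rule ccontr)
  assume "x \<noteq> y"
  have fin: "finite V" using rootedD(1)[OF rt] .
  have "x \<noteq> p" "y \<noteq> p" using rootedD(5)[OF rt, of x] rootedD(5)[OF rt, of y] x y by auto
  then have four: "card {p, r, x, y} = 4" using \<open>x \<noteq> y\<close> p x y by simp
  have sub: "{p, r, x, y} \<subseteq> V" using p x y rootedD(2)[OF rt] by simp
  have "edges_in E (V - {p}) = card {z \<in> V - {p}. z \<noteq> r \<and> par z \<in> V - {p}}"
    by (rule rooted_edges_in[OF rt]) auto
  also have "\<dots> \<le> card (V - {p, r, x, y})"
    using fin x y by (intro card_mono) auto
  also have "\<dots> = card V - 4" using four sub by (simp add: card_Diff_subset)
  finally have "edges_in E (V - {p}) \<le> card V - 4" .
  moreover have "card V \<ge> 4" using card_mono[OF fin sub] four by simp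
  ultimately show False using p(3) by (simp add: bd_def)
qed

lemma two_hub_tree_is_spider:
  fixes V :: "'a set"
  assumes rt: "rooted V E u par ht" and v: "v \<in> V" "u \<noteq> v"
    and low: "\<And>x. x \<in> V \<Longrightarrow> x \<noteq> u \<Longrightarrow> x \<noteq> v \<Longrightarrow> bd V E {x} \<le> 2"
    and high: "bd V E {u} \<ge> 3" "bd V E {v} \<ge> 3"
  obtains I :: "'a set" and l d h f where "finite I" "d > 0" "\<forall>i\<in>I. l i > 0"
    "graph_iso f V E (spider_verts I l d) (spider_edges I l d h)"
    "card {i \<in> I. h i} \<ge> 2" "card {i \<in> I. \<not> h i} \<ge> 2" "card I + 2 = bd V E {u} + bd V E {v}"
proof -
  have "x = y" if "x \<in> V" "y \<in> V" "x \<noteq> u" "y \<noteq> u" "par x = par y" "par x \<notin> {u, v}" for x y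
  proof (rule rooted_unique_child[OF rt])
    show "par x \<in> V" using rootedD(4)[OF rt] that by blast
    then show "bd V E {par x} \<le> 2" using low that by blast
  qed (use that in auto)
  then obtain f I l h where co: "spider_coords V u v par (ht v) f I l h"
    using exists_spider_coords[OF rt v] by blast
  let ?d = "ht v"
  have I: "finite I" using co rootedD(1)[OF rt] finite_subset unfolding spider_coords_def by blast
  have l: "\<And>i. i \<in> I \<Longrightarrow> l i > 0" and f: "bij_betw f V (spider_verts I l ?d)" "f u = C 0" "f v = C ?d"
    "\<And>x. x \<in> V \<Longrightarrow> x \<noteq> u \<Longrightarrow> f (par x) = spider_par ?d h (f x)"
    using co unfolding spider_coords_def by blast+
  have d: "?d > 0" using rootedD(5)[OF rt v(1)] v(2) by simp
  have iso: "graph_iso f V E (spider_verts I l ?d) (spider_edges I l ?d h)"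
    using rooted_graph_iso[OF rt spider_rooted[OF I] f(1,2,4)] .
  have E: "edges_within V E" using rooted_edge_subset[OF rt] by (simp add: edges_within_def)
  have "bd V E {u} = Suc (card {i \<in> I. h i})" "bd V E {v} = Suc (card {i \<in> I. \<not> h i})"
    using graph_iso_conn_sets(2)[OF iso E, of "{u}"] graph_iso_conn_sets(2)[OF iso E, of "{v}"]
      spider_hub_bd[OF I d l] f(2,3) rootedD(2)[OF rt] v(1) by simp_all
  moreover have "card I = card {i \<in> I. h i} + card {i \<in> I. \<not> h i}"
    using mset_set_split[OF I, of h] by (metis size_mset_set size_union)
  ultimately show ?thesis using that[OF I d _ iso] l high by simp
qed

text \<open>Degrees are the \<open>bd\<close> of the one-element connected sets, so every sum of a
  function of the degrees is determined. The indicator of degree at least 3 counts the hubs; cutting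
  the degree itself off below 3 gives their total, which fixes the number of legs.\<close>

lemma stat_mset_two_hub:
  fixes V :: "'a set" and V' :: "'b set"
  assumes rt: "rooted V E r par ht" "rooted V' E' r' par' ht'"
    and stat: "stat_mset V E = stat_mset V' E'" "card V = card V'"
    and uv: "{x \<in> V. bd V E {x} \<ge> 3} = {u, v}" "u \<noteq> v"
  obtains u' v' where "{x \<in> V'. bd V' E' {x} \<ge> 3} = {u', v'}" "u' \<noteq> v'"
    "bd V' E' {u'} + bd V' E' {v'} = bd V E {u} + bd V E {v}"
proof -
  note fin = rootedD(1)[OF rt(1)] rootedD(1)[OF rt(2)]
  have sum_eq: "(\<Sum>x\<in>V. g (bd V E {x})) = (\<Sum>x\<in>V'. g (bd V' E' {x}))" for g :: "nat \<Rightarrow> nat"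
    using stat_mset_sum[OF fin stat, of "\<lambda>k j. if k = 1 then g j else 0"]
    by (simp only: rooted_singletons[OF rt(1)] rooted_singletons[OF rt(2)])
  have "card {x \<in> V'. bd V' E' {x} \<ge> 3} = card {x \<in> V. bd V E {x} \<ge> 3}"
    using sum_eq[of "\<lambda>j. if j \<ge> 3 then 1 else 0"] fin by (simp add: sum.If_cases Int_def)
  also have "\<dots> = 2" using uv by simp
  finally obtain u' v' where uv': "{x \<in> V'. bd V' E' {x} \<ge> 3} = {u', v'}" "u' \<noteq> v'"
    by (meson card_2_iff)
  have "(\<Sum>x\<in>{x \<in> V. bd V E {x} \<ge> 3}. bd V E {x}) = (\<Sum>x\<in>{x \<in> V'. bd V' E' {x} \<ge> 3}. bd V' E' {x})"
    using sum_eq[of "\<lambda>j. if j \<ge> 3 then j else 0"] fin by (simp add: sum.inter_filter)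
  then have "bd V' E' {u'} + bd V' E' {v'} = bd V E {u} + bd V E {v}"
    unfolding uv uv' using uv(2) uv'(2) by simp
  then show ?thesis using that uv' by blast
qed

text \<open>Once the lengths agree, the legs of the second spider are renamed to those of the first,
  and \<open>g\<close> is its attachment after renaming. It matches \<open>h\<close> directly or
  after exchanging the hubs.\<close>

lemma spiders_iso:
  fixes I :: "'i set" and I' :: "'j set"
  assumes I: "finite I" "finite I'" and d: "d > 0" "d' > 0"
    and l: "\<And>i. i \<in> I \<Longrightarrow> l i > 0" "\<And>i. i \<in> I' \<Longrightarrow> l' i > 0"
    and h: "card {i \<in> I. h i} \<ge> 2" "card {i \<in> I. \<not> h i} \<ge> 2"
      "card {i \<in> I'. h' i} \<ge> 2" "card {i \<in> I'. \<not> h' i} \<ge> 2"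
    and card: "card I = card I'"
    and eq: "\<And>G. spider_conn_sum I l d h G (\<lambda>_. True) = spider_conn_sum I' l' d' h' G (\<lambda>_. True)"
  shows "\<exists>f. graph_iso f (spider_verts I l d) (spider_edges I l d h) (spider_verts I' l' d') (spider_edges I' l' d' h')"
proof -
  note det = spider_lengths_determined[OF I d l h card eq]
  have d': "d' = d" using det(1) by simp
  obtain \<sigma> where \<sigma>: "bij_betw \<sigma> I I'" "\<forall>i\<in>I. l' (\<sigma> i) = l i"
    using exists_bij_of_image_mset_eq[OF I det(2)] by blast
  define g where "g i = h' (\<sigma> i)" for i
  have within: "edges_within (spider_verts I l d) (spider_edges I l d f)" for f
    using rooted_edge_subset[OF spider_rooted[OF I(1)]] by (simp add: edges_within_def)
  have iso1: "graph_iso (spider_relabel \<sigma>) (spider_verts I l d) (spider_edges I l d g)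
      (spider_verts I' l' d') (spider_edges I' l' d' h')"
    unfolding d' by (rule spider_relabel_iso[OF I \<sigma>(1)]) (use \<sigma>(2) g_def in auto)
  have "spider_conn_sum I l d h G (\<lambda>_. True) = spider_conn_sum I l d g G (\<lambda>_. True)" for G
    using graph_iso_sum[OF iso1 within, of "\<lambda>_. True" "\<lambda>_. True" G] eq[of G]
    by (simp add: spider_conn_sum_def)
  from spider_legs_determined[OF I(1) d(1) l(1) this]
  consider "image_mset l (mset_set {i \<in> I. h i}) = image_mset l (mset_set {i \<in> I. g i})"
    | "image_mset l (mset_set {i \<in> I. h i}) = image_mset l (mset_set {i \<in> I. \<not> g i})"
    by blast
  then have "\<exists>f. graph_iso f (spider_verts I l d) (spider_edges I l d h) (spider_verts I l d) (spider_edges I l d g)"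
  proof cases
    case 1
    from exists_bij_preserving_part[OF I(1) this] obtain \<tau> where
      "bij_betw \<tau> I I" "\<forall>i\<in>I. l (\<tau> i) = l i \<and> g (\<tau> i) = h i" by blast
    then show ?thesis using spider_relabel_iso[OF I(1) I(1), of \<tau> l l g h d] by blast
  next
    case 2
    from exists_bij_preserving_part[OF I(1) this] obtain \<tau> where
      "bij_betw \<tau> I I" "\<forall>i\<in>I. l (\<tau> i) = l i \<and> (\<not> g (\<tau> i)) = h i" by blast
    then have "graph_iso (spider_relabel \<tau>) (spider_verts I l d) (spider_edges I l d h)
        (spider_verts I l d) (spider_edges I l d (\<lambda>i. \<not> g i))"
      using spider_relabel_iso[OF I(1) I(1), of \<tau> l l "\<lambda>i. \<not> g i" h d] by blast
    then show ?thesis using graph_iso_trans[OF _ spider_swap_iso[of d I l "\<lambda>i. \<not> g i"]] by auto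
  qed
  then show ?thesis using graph_iso_trans[OF _ iso1] by blast
qed

theorem theorem1p2:
  fixes T :: "'a multigraph" and F :: "'b multigraph"
  assumes "is_tree T"
    and "card {v \<in> vertices T. vertex_degree T v \<ge> 3} = 2"
    and "wf_multigraph F" and "no_multiple_edges F"
    and "chromatic_symmetric_function F = chromatic_symmetric_function T"
  shows "F \<cong>\<^sub>G T"
proof -
  let ?V = "vertices T" and ?E = "set_mset (edges T)"
  let ?V' = "vertices F" and ?E' = "set_mset (edges F)"
  have wfT: "wf_multigraph T" using assms(1) by (simp add: is_tree_def)
  obtain u v where uv: "{v \<in> ?V. vertex_degree T v \<ge> 3} = {u, v}" "u \<noteq> v"
    using assms(2) by (meson card_2_iff)
  then have uvV: "u \<in> ?V" "v \<in> ?V" by auto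
  obtain par ht where rT: "rooted ?V ?E u par ht" and simpleT: "edges T = mset_set ?E"
    using tree_rooted[OF assms(1) uvV(1)] .
  have "{x \<in> ?V. bd ?V ?E {x} \<ge> 3} = {v \<in> ?V. vertex_degree T v \<ge> 3}"
    using vertex_degree_eq_bd[OF rT simpleT] by auto
  then have hubs: "{x \<in> ?V. bd ?V ?E {x} \<ge> 3} = {u, v}" using uv(1) by simp
  have card: "card ?V' = card ?V" using csf_tree_card[OF assms(3) wfT assms(5) rT] .
  then have "?V' \<noteq> {}" using uvV(1) rootedD(1)[OF rT] by (metis card.empty card_0_eq empty_iff)
  then obtain r where "r \<in> ?V'" by blast
  \<comment> \<open>The hubs of \<open>F\<close> are not known yet, so an arbitrary root is used to
    compare the statistics; below, \<open>F\<close> is rooted again at the hub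
    \<open>u'\<close>.\<close>
  then obtain par0 ht0 where rF0: "rooted ?V' ?E' r par0 ht0"
    using csf_tree_imp_rooted[OF assms(3) wfT assms(5) rT] by blast
  have stat: "stat_mset ?V ?E = stat_mset ?V' ?E'"
    using stat_mset_eq[OF assms(3) wfT assms(5) card rF0 rT] by simp
  obtain u' v' where uv': "{x \<in> ?V'. bd ?V' ?E' {x} \<ge> 3} = {u', v'}" "u' \<noteq> v'"
    and deg: "bd ?V' ?E' {u'} + bd ?V' ?E' {v'} = bd ?V ?E {u} + bd ?V ?E {v}"
    using stat_mset_two_hub[OF rT rF0 stat card[symmetric] hubs uv(2)] .
  have uvV': "u' \<in> ?V'" "v' \<in> ?V'" using uv'(1) by auto
  obtain par' ht' where rF: "rooted ?V' ?E' u' par' ht'"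
    using csf_tree_imp_rooted[OF assms(3) wfT assms(5) rT uvV'(1)] by blast
  have lowT: "bd ?V ?E {x} \<le> 2" if "x \<in> ?V" "x \<noteq> u" "x \<noteq> v" for x
  proof -
    have "x \<notin> {x \<in> ?V. bd ?V ?E {x} \<ge> 3}" unfolding hubs using that by simp
    then show ?thesis using that(1) by simp
  qed
  have lowF: "bd ?V' ?E' {x} \<le> 2" if "x \<in> ?V'" "x \<noteq> u'" "x \<noteq> v'" for x
  proof -
    have "x \<notin> {x \<in> ?V'. bd ?V' ?E' {x} \<ge> 3}" unfolding uv'(1) using that by simp
    then show ?thesis using that(1) by simp
  qed
  have high: "bd ?V ?E {u} \<ge> 3" "bd ?V ?E {v} \<ge> 3" "bd ?V' ?E' {u'} \<ge> 3" "bd ?V' ?E' {v'} \<ge> 3"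
    using hubs uv'(1) by blast+
  obtain I :: "'a set" and l d h f where T: "finite I" "d > 0" "\<forall>i\<in>I. l i > 0"
    and isoT: "graph_iso f ?V ?E (spider_verts I l d) (spider_edges I l d h)"
    and cT: "card {i \<in> I. h i} \<ge> 2" "card {i \<in> I. \<not> h i} \<ge> 2" "card I + 2 = bd ?V ?E {u} + bd ?V ?E {v}"
    using two_hub_tree_is_spider[OF rT uvV(2) uv(2) lowT high(1,2)] .
  obtain I' :: "'b set" and l' d' h' f' where F: "finite I'" "d' > 0" "\<forall>i\<in>I'. l' i > 0"
    and isoF: "graph_iso f' ?V' ?E' (spider_verts I' l' d') (spider_edges I' l' d' h')"
    and cF: "card {i \<in> I'. h' i} \<ge> 2" "card {i \<in> I'. \<not> h' i} \<ge> 2"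
      "card I' + 2 = bd ?V' ?E' {u'} + bd ?V' ?E' {v'}"
    using two_hub_tree_is_spider[OF rF uvV'(2) uv'(2) lowF high(3,4)] .
  have E: "edges_within ?V ?E" "edges_within ?V' ?E'"
    using rooted_edge_subset[OF rT] rooted_edge_subset[OF rF] by (simp_all add: edges_within_def)
  have pos: "l i > 0" if "i \<in> I" for i using T(3) that by blast
  have pos': "l' i > 0" if "i \<in> I'" for i using F(3) that by blast
  have cards: "card I' = card I" using cT(3) cF(3) deg by linarith
  have "spider_conn_sum I' l' d' h' G (\<lambda>_. True) = spider_conn_sum I l d h G (\<lambda>_. True)" for G
    using graph_iso_sum[OF isoT E(1), of "\<lambda>_. True" "\<lambda>_. True" G]
      graph_iso_sum[OF isoF E(2), of "\<lambda>_. True" "\<lambda>_. True" G]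
      stat_mset_sum[OF rootedD(1)[OF rT] rootedD(1)[OF rF] stat card[symmetric], of G]
    by (simp add: spider_conn_sum_def)
  from spiders_iso[OF F(1) T(1) F(2) T(2) pos' pos cF(1,2) cT(1,2) cards this]
  obtain k where "graph_iso k (spider_verts I' l' d') (spider_edges I' l' d' h')
      (spider_verts I l d) (spider_edges I l d h)" by blast
  then obtain k where k: "graph_iso k ?V' ?E' ?V ?E"
    using graph_iso_trans[OF graph_iso_trans[OF isoF] graph_iso_sym[OF isoT E(1)]] by blast
  \<comment> \<open>The isomorphism so far concerns edge sets; without multiple edges the set gives
    back the multiset.\<close>
  have "edges F = mset_set ?E'"
  proof (rule multiset_eqI)
    fix e
    show "count (edges F) e = count (mset_set ?E') e"
    proof (cases "e \<in># edges F")
      case True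
      then have "count (edges F) e \<ge> 1" by simp
      then show ?thesis using assms(4) True by (simp add: no_multiple_edges_def le_antisym)
    next
      case False
      then show ?thesis by (simp add: not_in_iff)
    qed
  qed
  moreover have "image_mset (map_uprod k) (mset_set ?E') = mset_set ?E"
    using k map_uprod_inj_on[OF _ E(2), of k] by (auto simp: graph_iso_def bij_betw_def image_mset_mset_set)
  ultimately have "image_mset (map_uprod k) (edges F) = edges T" using simpleT by simp
  then show ?thesis using k by (auto simp: isomorphic_def graph_iso_def)
qed

end
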